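(* Let $k\ge a\ge1$ be integers and let $J_{k,a}(n)$ be the number of lattice paths (as described in the context) satisfying the special $(k,a)$-conditions, with major index $n$, all of whose peaks have odd parity. Then \[ \sum_{n\ge0}J_{k,a}(n)q^n=\sum_{n_1,\ldots,n_{k-1}\ge0}\frac{q^{N_1(N_1+1)/2+N_2^2+\cdots+N_{k-1}^2+\sum_{j\ge1,\ a+2j\le k-1}2N_{a+2j}}\,(-q)_{N_1-1}\,(q^{N_1}+q^{2N_a})}{(q^2;q^2)_{n_1}\cdots(q^2;q^2)_{n_{k-1}}}, \] where $N_i=n_i+n_{i+1}+\cdots+n_{k-1}$ for $1\le i\le k-1$ and $N_k=0$.
   Context: Notation: $(a;q)_n=\prod_{i=0}^{n-1}(1-aq^i)$, $(a)_n=(a;q)_n$; for negative $n$, $(a;q)_n=(a;q)_\infty/(aq^n;q)_\infty$ (so $(-q)_{-1}=1/2$). Lattice paths: paths in the first quadrant starting on the $y$-axis and ending on the $x$-axis, using unit steps NE $(x,y)\to(x+1,y+1)$, SE $(x,y)\to(x+1,y-1)$, N $(x,y-1)\to(x,y)$, and E $(x,0)\to(x+1,0)$ (E steps only at height $0$). Height = $y$-coordinate, weight = $x$-coordinate. A peak is a vertex preceded by an NE step (NESE peak) or an N step (NSE peak) and followed by an SE step. Paths are empty or end with an SE step; as stated in the paper, if the leftmost peak is an NSE peak, the path must start with an NE step, except when it starts at $(0,0)$ with an E step. Major index = sum of weights of peaks. Special $(k,a)$-conditions: the path starts at height $k-a$ and all heights are $<k$. The relative height of a peak $(x,y)$ is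 the largest integer $h$ for which there are two vertices $(x',y-h)$ and $(x'',y-h)$ of the path with $x'\le x<x''$ such that between these two vertices there is no peak of height $>y$ and every peak of height $y$ has abscissa $\ge x$. $W(x)$ is the number of NSE peaks with weight $\le x$. The parity of a peak $(x,y)$ of relative height $r$ is the opposite of the parity of $x-r-W(x)$ (the peak is odd iff $x-r-W(x)$ is even).
   Formalization: In the rule for paths whose leftmost peak is an NSE peak, "start with an NE step" is corrected to "start with an SE step" (as printed the identity fails for k=2, a=1, n=2), and every N step is required to be followed by an SE step (otherwise it fails for k=3, a=1, n=3). *)

theory Defs
  imports "HOL-Analysis.Analysis"
begin

section \<open>Lattice paths\<close>

datatype step = NEstep | SEstep | Nstep | Estep

fun displacement :: "step \<Rightarrow> int \<times> int" where
  "displacement NEstep = (1, 1)"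
| "displacement SEstep = (1, -1)"
| "displacement Nstep = (0, 1)"
| "displacement Estep = (1, 0)"

text \<open>
  A path is given by its starting height on the $y$-axis and its list of steps. Its vertices are
  addressed by their position \<open>0, \<dots>, length\<close> along the path, because the two ends of a north step
  have the same abscissa.
\<close>

type_synonym path = "int \<times> step list"

abbreviation start_height :: "path \<Rightarrow> int" where "start_height \<equiv> fst"

abbreviation steps :: "path \<Rightarrow> step list" where "steps \<equiv> snd"

definition vertex :: "path \<Rightarrow> nat \<Rightarrow> int \<times> int" where
  "vertex p i = (0, start_height p) + sum_list (map displacement (take i (steps p)))"

definition weight :: "path \<Rightarrow> nat \<Rightarrow> int" where
  "weight p i = fst (vertex p i)"

definition height :: "path \<Rightarrow> nat \<Rightarrow> int" where
  "height p i = snd (vertex p i)"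

definition NESE_peaks :: "path \<Rightarrow> nat set" where
  "NESE_peaks p = {i. 0 < i \<and> i < length (steps p) \<and>
     steps p ! (i - 1) = NEstep \<and> steps p ! i = SEstep}"

definition NSE_peaks :: "path \<Rightarrow> nat set" where
  "NSE_peaks p = {i. 0 < i \<and> i < length (steps p) \<and>
     steps p ! (i - 1) = Nstep \<and> steps p ! i = SEstep}"

definition peaks :: "path \<Rightarrow> nat set" where
  "peaks p = NESE_peaks p \<union> NSE_peaks p"

text \<open>
  Two conventions on north steps.

  \<^item> A north step occurs only as part of an NSE peak, i.e. it is followed by an SE step.

  \<^item> If the leftmost peak is an NSE peak, the path starts with an SE step, or it starts at $(0,0)$
    with an E step. The source prints NE for SE here. With NE the generating function identity
    fails for $k = 2$, $a = 1$: only heights $0$ and $1$ are allowed and the path starts at height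
    $1$, so it cannot start with an NE step. The only path of major index $2$ with odd peaks is
    SE, E, N, SE, which would then be excluded, whereas the coefficient of $q^2$ in the multiple
    series is $1$.
\<close>

definition lattice_path :: "path \<Rightarrow> bool" where
  "lattice_path p \<longleftrightarrow>
     (\<forall>i\<le>length (steps p). 0 \<le> height p i) \<and>
     height p (length (steps p)) = 0 \<and>
     (\<forall>i<length (steps p). steps p ! i = Estep \<longrightarrow> height p i = 0) \<and>
     (\<forall>i<length (steps p). steps p ! i = Nstep \<longrightarrow>
        Suc i < length (steps p) \<and> steps p ! Suc i = SEstep) \<and>
     (steps p = [] \<or> last (steps p) = SEstep) \<and>
     (peaks p \<noteq> {} \<and> Min (peaks p) \<in> NSE_peaks p \<longrightarrow>
        hd (steps p) = SEstep \<or> (start_height p = 0 \<and> hd (steps p) = Estep))"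

definition special_conditions :: "nat \<Rightarrow> nat \<Rightarrow> path \<Rightarrow> bool" where
  "special_conditions k a p \<longleftrightarrow>
     start_height p = int k - int a \<and> (\<forall>i\<le>length (steps p). height p i < int k)"

definition major_index :: "path \<Rightarrow> int" where
  "major_index p = (\<Sum>i\<in>peaks p. weight p i)"

text \<open>``Between'' refers to the order of the vertices along the path.\<close>

definition relative_height :: "path \<Rightarrow> nat \<Rightarrow> int" where
  "relative_height p i = (GREATEST h. \<exists>l\<le>length (steps p). \<exists>m\<le>length (steps p).
     height p l = height p i - h \<and> height p m = height p i - h \<and>
     weight p l \<le> weight p i \<and> weight p i < weight p m \<and>
     (\<forall>j\<in>peaks p. l \<le> j \<and> j \<le> m \<longrightarrow>
        \<not> height p j > height p i \<and>
        (height p j = height p i \<longrightarrow> weight p j \<ge> weight p i)))"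

definition NSE_count :: "path \<Rightarrow> int \<Rightarrow> nat" where
  "NSE_count p x = card {j \<in> NSE_peaks p. weight p j \<le> x}"

definition odd_peak :: "path \<Rightarrow> nat \<Rightarrow> bool" where
  "odd_peak p i \<longleftrightarrow>
     even (weight p i - relative_height p i - int (NSE_count p (weight p i)))"

definition J :: "nat \<Rightarrow> nat \<Rightarrow> nat \<Rightarrow> nat" where
  "J k a n = card {p. lattice_path p \<and> special_conditions k a p \<and>
     major_index p = int n \<and> (\<forall>i\<in>peaks p. odd_peak p i)}"


text \<open>$N_i = n_i + \cdots + n_{k-1}$, so that $N_k = 0$.\<close>

definition partial_sum_N :: "nat \<Rightarrow> (nat \<Rightarrow> nat) \<Rightarrow> nat \<Rightarrow> nat" where
  "partial_sum_N k ns i = (\<Sum>j\<in>{i..<k}. ns j)"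


section \<open>q-Pochhammer symbols\<close>

text \<open>
  Everything takes place in the ring of formal power series with its usual ($X$-adic) topology.
\<close>

definition qpoch_inf :: "rat fps \<Rightarrow> rat fps \<Rightarrow> rat fps" where
  "qpoch_inf a q = prodinf (\<lambda>i. 1 - a * q ^ i)"

text \<open>
  For negative $n$ the value is $(a;q)_\infty / (aq^n;q)_\infty$, where $aq^n$ is written as the
  quotient of $a$ by $q^{-n}$. Division of formal power series truncates, so this is meaningful
  only if $q^{-n}$ divides $a$; it does for $(-q;q)_{-1}$, see below.
\<close>

definition qpoch :: "rat fps \<Rightarrow> rat fps \<Rightarrow> int \<Rightarrow> rat fps" where
  "qpoch a q n =
     (if 0 \<le> n then \<Prod>i<nat n. (1 - a * q ^ i)
      else qpoch_inf a q / qpoch_inf (a / q ^ nat (- n)) q)"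

lemma qpoch_inf_tendsto:
  "\<exists>L. (\<lambda>n. \<Prod>i\<le>n. 1 + fps_X ^ Suc i :: rat fps) \<longlonglongrightarrow> L \<and> fps_nth L 0 = 1"
proof -
  define P where "P = (\<lambda>n. \<Prod>i\<le>n. 1 + fps_X ^ Suc i :: rat fps)"
  have P_Suc: "P (Suc n) = P n + P n * fps_X ^ Suc (Suc n)" for n
    by (simp add: P_def algebra_simps)
  have stable: "fps_nth (P (m + d)) m = fps_nth (P m) m" for m d
  proof (induction d)
    case (Suc d)
    then show ?case by (simp add: P_Suc fps_X_power_mult_right_nth del: power_Suc)
  qed simp
  define L where "L = Abs_fps (\<lambda>m. fps_nth (P m) m)"
  have "P \<longlonglongrightarrow> L"
  proof (rule tendsto_fpsI)
    fix m
    show "\<forall>\<^sub>F n in sequentially. fps_nth (P n) m = fps_nth L m"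
      unfolding eventually_sequentially L_def
      by (metis fps_nth_Abs_fps le_Suc_ex stable)
  qed
  moreover have "fps_nth L 0 = 1" by (simp add: L_def P_def)
  ultimately show ?thesis unfolding P_def by blast
qed

lemma qpoch_minus_one: "qpoch (- fps_X) fps_X (- 1) = fps_const (1 / 2)"
proof -
  obtain L :: "rat fps" where L: "(\<lambda>n. \<Prod>i\<le>n. 1 + fps_X ^ Suc i) \<longlonglongrightarrow> L" "fps_nth L 0 = 1"
    using qpoch_inf_tendsto by blast
  have L0: "L \<noteq> 0" using L(2) by auto
  have 1: "(\<lambda>i. 1 - (- fps_X) * fps_X ^ i) has_prod L"
    using L L0 by (simp add: has_prod_def raw_has_prod_def)
  have lim2: "(\<lambda>n. \<Prod>i\<le>n. 1 + fps_X ^ i :: rat fps) \<longlonglongrightarrow> fps_const 2 * L"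
  proof (rule LIMSEQ_offset[where k = 1], rule tendsto_fpsI)
    fix m
    have "(\<Prod>i\<le>n + 1. 1 + fps_X ^ i :: rat fps) = fps_const 2 * (\<Prod>i\<le>n. 1 + fps_X ^ Suc i)" for n
      by (simp add: prod.atMost_Suc_shift del: prod.atMost_Suc power_Suc)
    moreover have "\<forall>\<^sub>F n in sequentially. fps_nth (\<Prod>i\<le>n. 1 + fps_X ^ Suc i) m = fps_nth L m"
      using L(1) unfolding tendsto_fps_iff by blast
    ultimately show "\<forall>\<^sub>F n in sequentially.
        fps_nth (\<Prod>i\<le>n + 1. 1 + fps_X ^ i :: rat fps) m = fps_nth (fps_const 2 * L) m"
      by (simp del: power_Suc prod.atMost_Suc)
  qed
  have "- fps_X / fps_X ^ nat (- (- 1)) = (- 1 :: rat fps)"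
    by (metis (no_types) fps_X_neq_zero minus_minus mult_minus1 nat_1 nonzero_mult_div_cancel_right
        One_nat_def power_one_right)
  moreover have "(\<lambda>i. 1 - (- 1) * fps_X ^ i) has_prod (fps_const 2 * L)"
    using lim2 L0 by (simp add: has_prod_def raw_has_prod_def)
  ultimately have "qpoch (- fps_X) fps_X (- 1) = L / (fps_const 2 * L)"
    using 1 unfolding qpoch_def qpoch_inf_def by (metis has_prod_unique neg_0_le_iff_le not_one_le_zero)
  also have "\<dots> = (fps_const (1 / 2) * (fps_const 2 * L)) / (fps_const 2 * L)"
    by (simp flip: mult.assoc)
  also have "\<dots> = fps_const (1 / 2)"
    using L0 by (intro nonzero_mult_div_cancel_right) simp
  finally show ?thesis .
qed

end

theory Submission
  imports Defs
begin

text \<open>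
  Along a lattice path the abscissa plus the number of north steps passed equals the position, so a
  peak at position \<open>i\<close> is odd iff \<open>i\<close> has the parity of its relative height. The height of a
  peak minus its relative height is the height of a valley (its key saddle in the sense of
  topographic prominence), and every valley arises in this way from some peak. Hence all peaks are odd iff all valleys are at even positions, which is a local
  condition. Splitting off the first step gives recurrences for the generating functions of such
  paths with a fixed number of peaks, and these collapse to a three-term recurrence in the starting
  height (in steps of two). On the series side, fixing \<open>N\<^sub>1\<close> and summing over \<open>N\<^sub>2\<close> is a Bailey-type
  transformation that preserves this three-term recurrence, so the multiple series satisfies it by
  induction on \<open>k\<close>.
\<close>

(* This simproc rewrites powers of fps_X into monomials of polynomials and blocks power_add. *)
declare [[simproc del: poly_fps_eq]]

section \<open>The multiple series\<close>

text \<open>N_1 is the number of peaks, and both sides are compared for each value N of it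
  separately. Replacing the last NE step before a peak by a north step keeps all positions and
  heights, hence all parities, and moves that peak and the later ones one unit to the left. So each
  peak contributes a factor 1 + q^i, where i counts the peaks from it onwards. The first peak of a
  path that opens with an ascent offers no such choice; together with the paths that open with a
  descent this leaves (-q)_{N_1-1} and the factor q^(N_1) + q^(2 N_a). The quantity that matches on
  the two sides is the difference f(h) - q^(2N) f(h - 2) of the series for starting heights h and h
  - 2. For paths it isolates those that open with an ascent. For chain sums it vanishes at the top
  height, and its recurrence has an inhomogeneous term with N - 1 in place of N. Hence, by induction
  on N, the difference is determined from the top height downwards and f from height 0
  upwards.\<close>

definition Qfac :: "nat \<Rightarrow> rat fps" where
  "Qfac m = (\<Prod>i<m. 1 - fps_X\<^sup>2 * (fps_X\<^sup>2) ^ i)"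

definition inv_Qfac :: "nat \<Rightarrow> rat fps" where
  "inv_Qfac m = inverse (Qfac m)"

lemma Qfac_Suc: "Qfac (Suc m) = Qfac m * (1 - fps_X ^ (2 * Suc m))"
  by (simp only: Qfac_def prod.lessThan_Suc power_mult power_Suc)

lemma Qfac_nth_0: "fps_nth (Qfac m) 0 = 1"
  by (induction m) (simp_all add: Qfac_Suc, simp add: Qfac_def)

lemma inv_Qfac_0: "inv_Qfac 0 = 1"
  by (simp add: inv_Qfac_def Qfac_def)

lemma inv_Qfac_Suc: "(1 - fps_X ^ (2 * Suc m)) * inv_Qfac (Suc m) = inv_Qfac m"
proof -
  have "inverse (Qfac (Suc m)) = inverse (Qfac m) * inverse (1 - fps_X ^ (2 * Suc m))"
    unfolding Qfac_Suc by (rule fps_inverse_mult)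
  moreover have "inverse (1 - fps_X ^ (2 * Suc m)) * (1 - fps_X ^ (2 * Suc m) :: rat fps) = 1"
    by (rule inverse_mult_eq_1) simp
  ultimately show ?thesis by (simp add: inv_Qfac_def mult.commute mult.assoc)
qed

text \<open>Uses 1/(q^2;q^2)_(r-1) = (1 - q^(2r))/(q^2;q^2)_r with r = N - M. Both sums then carry
  the weight \<open>inv_Qfac (N - M)\<close>; the extra term M = N on the right is killed by 1 -
  q^0.\<close>

lemma inv_Qfac_pred:
  "(\<Sum>M<N. t M * inv_Qfac (N - Suc M)) = (\<Sum>M\<le>N. t M * (1 - fps_X ^ (2 * (N - M))) * inv_Qfac (N - M))"
proof -
  have "t M * inv_Qfac (N - Suc M) = t M * (1 - fps_X ^ (2 * (N - M))) * inv_Qfac (N - M)" if "M < N" for M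
  proof -
    have "N - M = Suc (N - Suc M)" using that by simp
    then show ?thesis using inv_Qfac_Suc[of "N - Suc M"] by (simp add: mult.assoc)
  qed
  then have "(\<Sum>M<N. t M * inv_Qfac (N - Suc M)) = (\<Sum>M<N. t M * (1 - fps_X ^ (2 * (N - M))) * inv_Qfac (N - M))"
    by (intro sum.cong) auto
  then show ?thesis by (simp flip: lessThan_Suc_atMost)
qed

text \<open>
  The sum over \<open>N\<^sub>2, \<dots>, N\<^bsub>k-1\<^esub>\<close> for fixed \<open>N\<^sub>1 = N\<close>, where \<open>k = m + 1\<close> and \<open>a = k - h\<close>, without the
  factors of the summand that depend on \<open>N\<^sub>1\<close> alone. The subtraction \<open>h - 2\<close> is meant to truncate: for
  \<open>a \<ge> k\<close> the linear part of the exponent is empty.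
\<close>

fun chain_sum :: "nat \<Rightarrow> nat \<Rightarrow> nat \<Rightarrow> rat fps" where
  "chain_sum 0 h N = (if N = 0 then 1 else 0)"
| "chain_sum (Suc m) h N = (\<Sum>M\<le>N. (if h = Suc m then fps_X ^ (2 * N) * (fps_X ^ M\<^sup>2 * chain_sum m (h - 2) M)
      else fps_X ^ M\<^sup>2 * chain_sum m h M) * inv_Qfac (N - M))"

lemma chain_sum_at_0: "chain_sum m h 0 = 1"
proof (induction m arbitrary: h)
  case (Suc m)
  have 0: "sum f {..0} = f 0" for f :: "nat \<Rightarrow> rat fps" by simp
  show ?case by (simp only: chain_sum.simps 0) (simp add: Suc inv_Qfac_0)
qed simp

text \<open>For h = m the linear exponent contains N_1; its factor q^(2N) comes out and leaves the
  exponent belonging to h - 2. This is the boundary condition at the top height.\<close>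

lemma chain_sum_top: "chain_sum m m N = fps_X ^ (2 * N) * chain_sum m (m - 2) N"
  by (cases m) (auto simp: sum_distrib_left mult.assoc intro!: sum.cong)

lemma chain_sum_step: "h \<le> m \<Longrightarrow> chain_sum (Suc m) h N = (\<Sum>M\<le>N. fps_X ^ M\<^sup>2 * chain_sum m h M * inv_Qfac (N - M))"
  by simp

text \<open>Writes level N with the weights of level N + 1, so that the two levels can be compared
  term by term.\<close>

lemma chain_sum_step_pred:
  assumes "h \<le> m"
  shows "chain_sum (Suc m) h N =
    (\<Sum>M\<le>Suc N. fps_X ^ M\<^sup>2 * chain_sum m h M * (1 - fps_X ^ (2 * (Suc N - M))) * inv_Qfac (Suc N - M))"
  using inv_Qfac_pred[of "\<lambda>M. fps_X ^ M\<^sup>2 * chain_sum m h M" "Suc N"] assms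
  by (simp add: lessThan_Suc_atMost)

declare chain_sum.simps(2)[simp del]

text \<open>The recurrence one step below the top. With K = N + 1, splitting q^(2K) into q^(2M)
  q^(2(K - M)) lets \<open>chain_sum_top\<close> absorb q^(2M); the remaining factor 1 - q^(2(K -
  M)) lowers K to N.\<close>

lemma chain_sum_subtop:
  "chain_sum (Suc m) m (Suc N) - fps_X ^ (2 * Suc N) * chain_sum (Suc m) (m - 2) (Suc N) = chain_sum (Suc m) m N"
proof -
  let ?X = "fps_X :: rat fps"
  have *: "?X ^ (2 * Suc N) = ?X ^ (2 * M) * ?X ^ (2 * (Suc N - M))" if "M \<le> Suc N" for M
    using that by (metis le_add_diff_inverse power_add distrib_left)
  have "chain_sum (Suc m) m (Suc N) - ?X ^ (2 * Suc N) * chain_sum (Suc m) (m - 2) (Suc N) =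
     (\<Sum>M\<le>Suc N. ?X ^ M\<^sup>2 * chain_sum m m M * inv_Qfac (Suc N - M)
        - ?X ^ (2 * Suc N) * (?X ^ M\<^sup>2 * chain_sum m (m - 2) M * inv_Qfac (Suc N - M)))"
    by (simp only: chain_sum_step[of m m] chain_sum_step[of "m - 2" m] le_refl diff_le_self sum_subtractf sum_distrib_left)
  also have "\<dots> = (\<Sum>M\<le>Suc N. ?X ^ M\<^sup>2 * chain_sum m m M * (1 - ?X ^ (2 * (Suc N - M))) * inv_Qfac (Suc N - M))"
  proof (rule sum.cong[OF refl])
    fix M assume "M \<in> {..Suc N}"
    then have "M \<le> Suc N" by simp
    show "?X ^ M\<^sup>2 * chain_sum m m M * inv_Qfac (Suc N - M)
        - ?X ^ (2 * Suc N) * (?X ^ M\<^sup>2 * chain_sum m (m - 2) M * inv_Qfac (Suc N - M))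
      = ?X ^ M\<^sup>2 * chain_sum m m M * (1 - ?X ^ (2 * (Suc N - M))) * inv_Qfac (Suc N - M)"
      unfolding *[OF \<open>M \<le> Suc N\<close>] chain_sum_top[of m M] by algebra
  qed
  also have "\<dots> = chain_sum (Suc m) m N"
    by (rule chain_sum_step_pred[symmetric]) simp
  finally show ?thesis .
qed

text \<open>Shifting the coefficients by one index produces the same factor as lowering N in
  \<open>inv_Qfac_pred\<close>. This is how the predecessor term of a recurrence in M becomes one in
  N.\<close>

lemma sum_shift_inv_Qfac:
  "(\<Sum>M\<le>N. (case M of 0 \<Rightarrow> 0 | Suc M' \<Rightarrow> t M') * inv_Qfac (N - M)) =
   (\<Sum>M\<le>N. t M * (1 - fps_X ^ (2 * (N - M))) * inv_Qfac (N - M))"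
proof -
  have "(\<Sum>M\<le>N. (case M of 0 \<Rightarrow> 0 | Suc M' \<Rightarrow> t M') * inv_Qfac (N - M)) = (\<Sum>M<N. t M * inv_Qfac (N - Suc M))"
    by (cases N) (simp_all add: sum.atMost_Suc_shift lessThan_Suc_atMost del: sum.atMost_Suc)
  then show ?thesis by (simp add: inv_Qfac_pred)
qed

text \<open>The induction step sums the recurrence for each M with the weights q^(M^2)/(q^2;q^2)_(K
  - M), where K = N + 1. When h + 2 is the new top height, the induction hypothesis does not reach
  it and \<open>chain_sum_subtop\<close> takes its place. The claim is arranged in differences f(h)
  - q^(2K) f(h - 2), the form needed for ascents of paths.\<close>

lemma chain_sum_recurrence:
  assumes "h + 2 \<le> m"
  shows "chain_sum m h (Suc N) - fps_X ^ (2 * Suc N) * chain_sum m (h - 2) (Suc N) =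
    fps_X ^ (2 * Suc N) * (chain_sum m (h + 2) (Suc N) - fps_X ^ (2 * Suc N) * chain_sum m h (Suc N))
    + (1 + fps_X ^ (2 * N + 1)) * chain_sum m h N"
  using assms
proof (induction m arbitrary: h N)
  case (Suc m)
  let ?X = "fps_X :: rat fps"
  define K where "K = Suc N"
  define t where "t = (\<lambda>h M. ?X ^ M\<^sup>2 * chain_sum m h M)"
  have tD: "chain_sum (Suc m) h' N' = (\<Sum>M\<le>N'. t h' M * inv_Qfac (N' - M))" if "h' \<le> m" for h' N'
    using that by (simp add: chain_sum_step t_def)
  have pow: "?X ^ (2 * K) = ?X ^ (2 * (K - M)) * ?X ^ (2 * M)" if "M \<le> K" for M
    using that by (simp flip: power_add)
  have t0: "t h 0 = 1" for h by (simp add: t_def chain_sum_at_0)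
  show ?case
  proof (cases "h + 2 \<le> m")
    case True
    (* Multiplying the induction hypothesis for M by X^(2(K - M)) avoids negative powers of X. *)
    define s where "s = (\<lambda>M. ?X ^ (2 * (K - Suc M)) * (1 + ?X ^ (2 * M + 1)) * ?X ^ (2 * M + 1) * t h M)"
    have pt: "?X ^ (2 * K) * (t (h - 2) M + t (h + 2) M) =
       ?X ^ (2 * (K - M)) * (1 + ?X ^ (4 * M)) * t h M - (case M of 0 \<Rightarrow> 0 | Suc M' \<Rightarrow> s M')"
      if "M \<le> K" for M
    proof (cases M)
      case 0
      then show ?thesis by (simp add: t0)
    next
      case (Suc M')
      have e: "?X ^ M\<^sup>2 = ?X ^ M'\<^sup>2 * ?X ^ (2 * M' + 1)"
        unfolding Suc by (simp add: power2_eq_square flip: power_add)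
      have p4: "?X ^ (4 * M) = ?X ^ (2 * M) * ?X ^ (2 * M)" by (simp flip: power_add)
      have IH: "chain_sum m h M - ?X ^ (2 * M) * chain_sum m (h - 2) M =
          ?X ^ (2 * M) * (chain_sum m (h + 2) M - ?X ^ (2 * M) * chain_sum m h M) + (1 + ?X ^ (2 * M' + 1)) * chain_sum m h M'"
        using Suc.IH[OF True, of M'] Suc by simp
      have IH': "?X ^ (2 * M) * (chain_sum m (h - 2) M + chain_sum m (h + 2) M) =
          (1 + ?X ^ (2 * M) * ?X ^ (2 * M)) * chain_sum m h M - (1 + ?X ^ (2 * M' + 1)) * chain_sum m h M'"
        using IH by (simp add: algebra_simps)
      have "?X ^ (2 * K) * (t (h - 2) M + t (h + 2) M) = ?X ^ (2 * (K - M)) * ?X ^ M\<^sup>2 *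
         (?X ^ (2 * M) * (chain_sum m (h - 2) M + chain_sum m (h + 2) M))"
        unfolding t_def pow[OF that] by algebra
      also have "\<dots> = ?X ^ (2 * (K - M)) * (1 + ?X ^ (4 * M)) * t h M - s M'"
        unfolding IH' t_def s_def p4 e Suc[symmetric] by algebra
      finally show ?thesis by (simp add: Suc)
    qed
    have "?X ^ (2 * K) * (chain_sum (Suc m) (h - 2) K + chain_sum (Suc m) (h + 2) K)
       = (\<Sum>M\<le>K. ?X ^ (2 * K) * (t (h - 2) M + t (h + 2) M) * inv_Qfac (K - M))"
      using True by (simp only: tD distrib_left sum.distrib sum_distrib_left distrib_right mult.assoc)
    also have "\<dots> = (\<Sum>M\<le>K. ?X ^ (2 * (K - M)) * (1 + ?X ^ (4 * M)) * t h M * inv_Qfac (K - M))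
        - (\<Sum>M\<le>K. (case M of 0 \<Rightarrow> 0 | Suc M' \<Rightarrow> s M') * inv_Qfac (K - M))"
      unfolding sum_subtractf[symmetric] by (intro sum.cong[OF refl]) (simp only: pt left_diff_distrib atMost_iff)
    \<comment> \<open>The predecessor terms are shifted back, so that every summand becomes a
      multiple of \<open>t h M\<close> and only the scalar coefficients remain to be
      compared.\<close>
    also have "\<dots> = (\<Sum>M\<le>K. (?X ^ (2 * (K - M)) * (1 + ?X ^ (4 * M)) * t h M
         - s M * (1 - ?X ^ (2 * (K - M)))) * inv_Qfac (K - M))"
      unfolding sum_shift_inv_Qfac sum_subtractf[symmetric] by (intro sum.cong[OF refl]) algebra
    also have "\<dots> = (\<Sum>M\<le>K. (1 + ?X ^ (4 * K)) * (t h M * inv_Qfac (K - M))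
        - (1 + ?X ^ (2 * N + 1)) * (t h M * (1 - ?X ^ (2 * (K - M))) * inv_Qfac (K - M)))"
    proof (rule sum.cong[OF refl])
      fix M assume "M \<in> {..K}"
      then have MK: "M \<le> K" by simp
      show "(?X ^ (2 * (K - M)) * (1 + ?X ^ (4 * M)) * t h M - s M * (1 - ?X ^ (2 * (K - M)))) * inv_Qfac (K - M) =
        (1 + ?X ^ (4 * K)) * (t h M * inv_Qfac (K - M))
        - (1 + ?X ^ (2 * N + 1)) * (t h M * (1 - ?X ^ (2 * (K - M))) * inv_Qfac (K - M))"
      \<comment> \<open>At M = K the exponent in \<open>s\<close> is truncated, but
        \<open>s K\<close> is multiplied by 1 - q^0 = 0.\<close>
      proof (cases "M = K")
        case True
        then show ?thesis by (simp add: algebra_simps)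
      next
        case False
        then obtain d where d: "K = M + Suc d" using MK less_iff_Suc_add[of M K] by auto
        then have N: "N = M + d" by (simp add: K_def)
        have 1: "K - M = Suc d" "K - Suc M = d" using d by auto
        have 2: "?X ^ (4 * K) = (?X ^ M) ^ 4 * (?X ^ d) ^ 4 * ?X ^ 4"
          by (simp add: d power_add power_mult mult.commute flip: power_mult)
        have 3: "?X ^ (2 * N + 1) = (?X ^ M) ^ 2 * (?X ^ d) ^ 2 * ?X"
          by (simp add: N power_add power_mult mult.commute flip: power_mult)
        have 4: "?X ^ (2 * Suc d) = (?X ^ d) ^ 2 * ?X ^ 2" "?X ^ (2 * d) = (?X ^ d) ^ 2"
          "?X ^ (4 * M) = (?X ^ M) ^ 4" "?X ^ (2 * M + 1) = (?X ^ M) ^ 2 * ?X"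
          by (simp_all add: power_add mult.commute power2_eq_square[of ?X] flip: power_mult)
        show ?thesis unfolding s_def 1 2 3 4 by algebra
      qed
    qed
    also have "\<dots> = (1 + ?X ^ (4 * K)) * chain_sum (Suc m) h K - (1 + ?X ^ (2 * N + 1)) * chain_sum (Suc m) h N"
    proof -
      have "chain_sum (Suc m) h N = (\<Sum>M\<le>K. t h M * (1 - ?X ^ (2 * (K - M))) * inv_Qfac (K - M))"
        using chain_sum_step_pred[of h m N] True by (simp add: t_def K_def)
      then show ?thesis using True by (simp add: tD sum_subtractf sum_distrib_left)
    qed
    finally have main: "?X ^ (2 * K) * (chain_sum (Suc m) (h - 2) K + chain_sum (Suc m) (h + 2) K) =
       (1 + ?X ^ (4 * K)) * chain_sum (Suc m) h K - (1 + ?X ^ (2 * N + 1)) * chain_sum (Suc m) h N" .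
    have p4: "?X ^ (4 * K) = ?X ^ (2 * K) * ?X ^ (2 * K)" by (simp flip: power_add)
    show ?thesis using main unfolding p4 K_def[symmetric] by (simp add: algebra_simps)
  next
    case False
    then have h: "Suc m = h + 2" using Suc.prems by simp
    have m: "m = Suc h" using h by simp
    \<comment> \<open>The extra factor q gives the predecessor term the exponent 2K instead of 2K -
      1; it is cancelled at the end of the case.\<close>
    have pt: "?X ^ (2 * K + 1) * t (h - 2) M =
       ?X ^ (2 * (K - M) + 1) * t h M - (case M of 0 \<Rightarrow> 0 | Suc M' \<Rightarrow> ?X ^ (2 * K) * t h M')"
      if "M \<le> K" for M
    proof (cases M)
      case 0
      then show ?thesis by (simp add: t0)
    next
      case (Suc M')
      have e: "?X ^ M\<^sup>2 * ?X = ?X ^ M'\<^sup>2 * ?X ^ (2 * M)"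
        unfolding Suc by (simp add: power2_eq_square flip: power_add power_Suc2)
      have II: "?X ^ (2 * M) * chain_sum m (h - 2) M = chain_sum m h M - chain_sum m h M'"
        using chain_sum_subtop[of h M'] unfolding m Suc by (simp add: algebra_simps)
      have "?X ^ (2 * K + 1) * t (h - 2) M = ?X ^ (2 * (K - M)) * (?X ^ M\<^sup>2 * ?X) * (?X ^ (2 * M) * chain_sum m (h - 2) M)"
        unfolding t_def power_add[of _ "2 * K"] pow[OF that] power_one_right by algebra
      also have "\<dots> = ?X ^ (2 * (K - M) + 1) * t h M - ?X ^ (2 * (K - M)) * (?X ^ M\<^sup>2 * ?X) * chain_sum m h M'"
        unfolding II t_def power_add[of _ "2 * (K - M)"] power_one_right by algebra
      also have "?X ^ (2 * (K - M)) * (?X ^ M\<^sup>2 * ?X) * chain_sum m h M' = ?X ^ (2 * K) * t h M'"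
        unfolding e t_def pow[OF that] by algebra
      finally show ?thesis by (simp add: Suc)
    qed
    \<comment> \<open>Hence the first term on the right of the recurrence vanishes.\<close>
    have top: "chain_sum (Suc m) (h + 2) K = ?X ^ (2 * K) * chain_sum (Suc m) h K"
      using chain_sum_top[of "Suc m" K] h by simp
    have hm: "h \<le> m" "h - 2 \<le> m" using m by auto
    have "?X ^ (2 * K + 1) * chain_sum (Suc m) (h - 2) K
       = (\<Sum>M\<le>K. ?X ^ (2 * K + 1) * t (h - 2) M * inv_Qfac (K - M))"
      using hm by (simp only: tD sum_distrib_left mult.assoc)
    also have "\<dots> = (\<Sum>M\<le>K. ?X ^ (2 * (K - M) + 1) * t h M * inv_Qfac (K - M))
        - (\<Sum>M\<le>K. (case M of 0 \<Rightarrow> 0 | Suc M' \<Rightarrow> ?X ^ (2 * K) * t h M') * inv_Qfac (K - M))"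
      unfolding sum_subtractf[symmetric] by (intro sum.cong[OF refl]) (simp only: pt left_diff_distrib atMost_iff)
    also have "\<dots> = (\<Sum>M\<le>K. ?X * (t h M * inv_Qfac (K - M))
        - ?X * (1 + ?X ^ (2 * N + 1)) * (t h M * (1 - ?X ^ (2 * (K - M))) * inv_Qfac (K - M)))"
    proof -
      have "?X ^ (2 * K) = ?X * ?X ^ (2 * N + 1)" by (simp add: K_def)
      then show ?thesis
        unfolding sum_shift_inv_Qfac sum_subtractf[symmetric]
        by (intro sum.cong[OF refl]) (simp add: algebra_simps)
    qed
    also have "\<dots> = ?X * (chain_sum (Suc m) h K - (1 + ?X ^ (2 * N + 1)) * chain_sum (Suc m) h N)"
    proof -
      have "chain_sum (Suc m) h N = (\<Sum>M\<le>K. t h M * (1 - ?X ^ (2 * (K - M))) * inv_Qfac (K - M))"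
        using chain_sum_step_pred[of h m N] hm by (simp add: t_def K_def)
      then show ?thesis using hm by (simp add: tD sum_subtractf sum_distrib_left right_diff_distrib mult.assoc)
    qed
    finally have "?X * (?X ^ (2 * K) * chain_sum (Suc m) (h - 2) K) =
      ?X * (chain_sum (Suc m) h K - (1 + ?X ^ (2 * N + 1)) * chain_sum (Suc m) h N)" by (simp add: mult.assoc)
    then have "?X ^ (2 * K) * chain_sum (Suc m) (h - 2) K = chain_sum (Suc m) h K - (1 + ?X ^ (2 * N + 1)) * chain_sum (Suc m) h N"
      by (simp only: mult_cancel_left fps_X_neq_zero simp_thms)
    then show ?thesis unfolding K_def[symmetric] top by (simp add: algebra_simps)
  qed
qed simp

section \<open>Generating functions of odd paths\<close>

text \<open>
  In the following the argument \<open>u\<close> is the step before the given list; at the start of a path it is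
  a virtual SE step. The flag \<open>g\<close> of \<open>odd_suffix\<close> tells whether the current position is even, i.e.
  whether a valley is allowed there.
\<close>

fun num_peaks :: "step \<Rightarrow> step list \<Rightarrow> nat" where
  "num_peaks u [] = 0"
| "num_peaks u (s # ss) = (if s = SEstep \<and> u \<in> {NEstep, Nstep} then 1 else 0) + num_peaks s ss"

text \<open>A first step other than a north step moves all later peaks one unit to the right, and so
  adds their number to the sum of their abscissas.\<close>

fun maj :: "step \<Rightarrow> step list \<Rightarrow> nat" where
  "maj u [] = 0"
| "maj u (s # ss) = maj s ss + (if s = Nstep then 0 else num_peaks s ss)"

text \<open>An up step after an SE or E step starts at a valley, which is where the flag is
  consulted; inside an ascent it is not. Excluding \<open>u = Nstep\<close> in all clauses but the
  one for SE forces an SE step after a north step.\<close>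

fun odd_suffix :: "nat \<Rightarrow> step \<Rightarrow> bool \<Rightarrow> nat \<Rightarrow> step list \<Rightarrow> bool" where
  "odd_suffix k u g h [] \<longleftrightarrow> h = 0 \<and> u = SEstep"
| "odd_suffix k u g h (NEstep # ss) \<longleftrightarrow>
     u \<noteq> Nstep \<and> (u = NEstep \<or> g) \<and> Suc h < k \<and> odd_suffix k NEstep (\<not> g) (Suc h) ss"
| "odd_suffix k u g h (SEstep # ss) \<longleftrightarrow> 0 < h \<and> odd_suffix k SEstep (\<not> g) (h - 1) ss"
| "odd_suffix k u g h (Nstep # ss) \<longleftrightarrow>
     u \<noteq> Nstep \<and> (u = NEstep \<or> g) \<and> Suc h < k \<and> odd_suffix k Nstep (\<not> g) (Suc h) ss"
| "odd_suffix k u g h (Estep # ss) \<longleftrightarrow> u \<noteq> Nstep \<and> h = 0 \<and> odd_suffix k Estep (\<not> g) 0 ss"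

text \<open>The local form of the convention on the leftmost peak: the path must not open with a run
  of NE steps, possibly empty, followed by a north step.\<close>

fun no_initial_NSE :: "step list \<Rightarrow> bool" where
  "no_initial_NSE (NEstep # ss) = no_initial_NSE ss"
| "no_initial_NSE (Nstep # ss) = False"
| "no_initial_NSE _ = True"

text \<open>The SE step after a peak moves all later peaks to the right, so at most one peak has
  abscissa 0.\<close>

lemma num_peaks_le_maj: "num_peaks u ss \<le> Suc (maj u ss)"
proof (induction ss arbitrary: u)
  case (Cons s ss)
  from Cons[of s] show ?case by (cases ss) auto
qed simp

text \<open>The path has to end with an SE step at height 0. From an ascent, or from height 0 with
  something left to do, it cannot do so without a peak.\<close>

lemma odd_suffix_num_peaks_pos:
  "odd_suffix k u g h ss \<Longrightarrow> u \<in> {NEstep, Nstep} \<or> h = 0 \<and> (ss \<noteq> [] \<or> u \<noteq> SEstep) \<Longrightarrow> 0 < num_peaks u ss"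
  by (induction k u g h ss rule: odd_suffix.induct) auto

text \<open>Behind the finiteness of all counted sets. An NE or E step is followed by a peak and so
  raises \<open>maj\<close>; an SE step lowers the height. A north step leaves \<open>maj\<close>
  alone and raises the height, so both units are charged to the peak that it forces: this is the
  extra 2.\<close>

lemma odd_suffix_length:
  "odd_suffix k u g h ss \<Longrightarrow> length ss + (if u = Nstep then 2 else 0) \<le> h + 2 * maj u ss + 2 * num_peaks u ss"
proof (induction k u g h ss rule: odd_suffix.induct)
  case (2 k u g h ss)
  then show ?case using odd_suffix_num_peaks_pos[of k NEstep "\<not> g" "Suc h" ss] by auto
next
  case (5 k u g h ss)
  then show ?case using odd_suffix_num_peaks_pos[of k Estep "\<not> g" 0 ss] by auto
qed auto

instance step :: finite
proof
  have "(UNIV :: step set) = {NEstep, SEstep, Nstep, Estep}"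
    using step.exhaust by blast
  then show "finite (UNIV :: step set)" by (metis finite.emptyI finite.insertI)
qed

lemma finite_odd_suffix: "finite {ss. odd_suffix k u g h ss \<and> num_peaks u ss = N \<and> maj u ss = n}"
proof (rule finite_subset)
  show "{ss. odd_suffix k u g h ss \<and> num_peaks u ss = N \<and> maj u ss = n}
    \<subseteq> {ss. set ss \<subseteq> UNIV \<and> length ss \<le> h + 2 * n + 2 * N}"
    using odd_suffix_length by fastforce
qed (rule finite_lists_length_le, simp)

definition path_gf :: "step \<Rightarrow> (step list \<Rightarrow> bool) \<Rightarrow> nat \<Rightarrow> rat fps" where
  "path_gf u P N = Abs_fps (\<lambda>n. of_nat (card {ss. P ss \<and> num_peaks u ss = N \<and> maj u ss = n}))"

text \<open>\<open>card\<close> is 0 on infinite sets, so counts can be added up over the first step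
  only under this condition.\<close>

definition finite_levels :: "step \<Rightarrow> (step list \<Rightarrow> bool) \<Rightarrow> bool" where
  "finite_levels u P \<longleftrightarrow> (\<forall>N n. finite {ss. P ss \<and> num_peaks u ss = N \<and> maj u ss = n})"

lemma finite_levels_odd_suffix: "finite_levels u (\<lambda>ss. odd_suffix k u g h ss \<and> Q ss)" "finite_levels u (odd_suffix k u g h)"
  using finite_odd_suffix unfolding finite_levels_def by (auto intro: finite_subset[OF _ finite_odd_suffix])

lemma finite_levels_False: "finite_levels u (\<lambda>ss. False)"
  by (simp add: finite_levels_def)

lemma path_gf_False: "path_gf u (\<lambda>ss. False) N = 0"
  by (simp add: path_gf_def fps_eq_iff)

lemma path_gf_eq_0:
  assumes "\<And>ss. P ss \<Longrightarrow> num_peaks u ss \<noteq> N"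
  shows "path_gf u P N = 0"
proof -
  have "{ss. P ss \<and> num_peaks u ss = N \<and> maj u ss = n} = {}" for n using assms by auto
  then show ?thesis unfolding path_gf_def by (simp only: card.empty) (simp add: fps_eq_iff)
qed

text \<open>If the first step completes a peak, that peak has abscissa 0 and the tail has N - 1
  peaks; otherwise the tail has N. The power of q records the shift of the peaks of the
  tail.\<close>

definition step_gf :: "step \<Rightarrow> step \<Rightarrow> (step list \<Rightarrow> bool) \<Rightarrow> nat \<Rightarrow> rat fps" where
  "step_gf u s P N =
    (if s = SEstep \<and> u \<in> {NEstep, Nstep}
     then (if N = 0 then 0 else fps_X ^ (N - 1) * path_gf s P (N - 1))
     else if s = Nstep then path_gf s P N else fps_X ^ N * path_gf s P N)"

lemma card_lists_first_step:
  assumes "\<And>s. finite {ss. Q (s # ss)}"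
  shows "card {ss. Q ss} = (if Q [] then 1 else 0) + card {ss. Q (NEstep # ss)}
    + card {ss. Q (SEstep # ss)} + card {ss. Q (Nstep # ss)} + card {ss. Q (Estep # ss)}"
proof -
  let ?S = "\<lambda>s. Cons s ` {ss. Q (s # ss)}"
  have split: "{ss. Q ss} = {ss. ss = [] \<and> Q ss} \<union> ?S NEstep \<union> ?S SEstep \<union> ?S Nstep \<union> ?S Estep"
    (is "?L = ?R")
  proof (rule set_eqI)
    fix ss
    show "ss \<in> ?L \<longleftrightarrow> ss \<in> ?R"
    proof (cases ss)
      case (Cons s ss')
      then show ?thesis by (cases s) auto
    qed auto
  qed
  have card_S: "card (?S s) = card {ss. Q (s # ss)}" for s
    by (intro card_image) simp
  have fin_S: "finite (?S s)" for s using assms by simp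
  have nil: "{ss. ss = [] \<and> Q ss} = (if Q [] then {[]} else {})" by auto
  have disj: "?S s \<inter> ?S s' = {}" if "s \<noteq> s'" for s s' using that by auto
  have disj_nil: "{ss. ss = [] \<and> Q ss} \<inter> ?S s = {}" for s by auto
  have "card {ss. Q ss} = card {ss. ss = [] \<and> Q ss} + card (?S NEstep) + card (?S SEstep)
      + card (?S Nstep) + card (?S Estep)"
    unfolding split by (simp add: card_Un_disjoint fin_S disj disj_nil Int_Un_distrib2)
  then show ?thesis by (simp add: card_S nil)
qed

lemma step_gf_nth:
  assumes "finite_levels s P"
  shows "fps_nth (step_gf u s P N) n =
    of_nat (card {ss. P ss \<and> num_peaks u (s # ss) = N \<and> maj u (s # ss) = n})"
proof -
  have *: "{ss. P ss \<and> num_peaks s ss = M \<and> maj s ss + num_peaks s ss = n} =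
     (if M \<le> n then {ss. P ss \<and> num_peaks s ss = M \<and> maj s ss = n - M} else {})" for M s
    by auto
  show ?thesis
  proof (cases "s = SEstep \<and> u \<in> {NEstep, Nstep}")
    case True
    then show ?thesis
      by (cases N) (auto simp: step_gf_def path_gf_def fps_X_power_mult_nth * not_less)
  next
    case False
    then show ?thesis
      by (cases "s = Nstep") (auto simp: step_gf_def path_gf_def fps_X_power_mult_nth * not_less)
  qed
qed

lemma path_gf_step:
  assumes "\<And>s. finite_levels s (\<lambda>ss. P (s # ss))"
  shows "path_gf u P N = (if P [] \<and> N = 0 then 1 else 0) + step_gf u NEstep (\<lambda>ss. P (NEstep # ss)) N
    + step_gf u SEstep (\<lambda>ss. P (SEstep # ss)) N + step_gf u Nstep (\<lambda>ss. P (Nstep # ss)) N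
    + step_gf u Estep (\<lambda>ss. P (Estep # ss)) N"
proof (rule fps_ext)
  fix n
  let ?Q = "\<lambda>ss. P ss \<and> num_peaks u ss = N \<and> maj u ss = n"
  have "finite {ss. ?Q (s # ss)}" for s
  proof -
    have "{ss. ?Q (s # ss)} \<subseteq> (\<Union>N'\<le>N. \<Union>n'\<le>n. {ss. P (s # ss) \<and> num_peaks s ss = N' \<and> maj s ss = n'})"
      by auto
    then show ?thesis
      by (rule finite_subset) (use assms in \<open>auto simp: finite_levels_def\<close>)
  qed
  then have "card {ss. ?Q ss} = (if ?Q [] then 1 else 0) + card {ss. ?Q (NEstep # ss)}
    + card {ss. ?Q (SEstep # ss)} + card {ss. ?Q (Nstep # ss)} + card {ss. ?Q (Estep # ss)}"
    by (rule card_lists_first_step)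
  then show "fps_nth (path_gf u P N) n = fps_nth ((if P [] \<and> N = 0 then 1 else 0) + step_gf u NEstep (\<lambda>ss. P (NEstep # ss)) N
    + step_gf u SEstep (\<lambda>ss. P (SEstep # ss)) N + step_gf u Nstep (\<lambda>ss. P (Nstep # ss)) N
    + step_gf u Estep (\<lambda>ss. P (Estep # ss)) N) n"
    by (auto simp: path_gf_def step_gf_nth assms simp del: num_peaks.simps(2) maj.simps(2))
qed

section \<open>First-step recurrences for odd paths\<close>

context
  fixes k :: nat
begin

abbreviation "gfA g h \<equiv> path_gf SEstep (odd_suffix k SEstep g h)"
abbreviation "gfU g h \<equiv> path_gf NEstep (odd_suffix k NEstep g h)"
abbreviation "gfN g h \<equiv> path_gf Nstep (odd_suffix k Nstep g h)"
abbreviation "gfE g \<equiv> path_gf Estep (odd_suffix k Estep g 0)"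
abbreviation "gfV g h \<equiv> path_gf NEstep (\<lambda>ss. odd_suffix k NEstep g h ss \<and> no_initial_NSE ss)"
abbreviation "gfJ h \<equiv> path_gf SEstep (\<lambda>ss. odd_suffix k SEstep True h ss \<and> no_initial_NSE ss)"

lemma finite_levels_step: "finite_levels s (\<lambda>ss. odd_suffix k u g h (s # ss))" "finite_levels s (\<lambda>ss. odd_suffix k u g h (s # ss) \<and> no_initial_NSE (s # ss))"
proof -
  have "finite_levels s (\<lambda>ss. odd_suffix k u g h (s # ss) \<and> Q ss)" for Q
    by (cases s; cases "u = Nstep"; cases "u = NEstep \<or> g"; cases "Suc h < k"; cases "h = 0")
      (auto simp: finite_levels_False finite_levels_odd_suffix)
  from this[of "\<lambda>_. True"] this[of "\<lambda>ss. no_initial_NSE (s # ss)"]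
  show "finite_levels s (\<lambda>ss. odd_suffix k u g h (s # ss))" "finite_levels s (\<lambda>ss. odd_suffix k u g h (s # ss) \<and> no_initial_NSE (s # ss))"
    by simp_all
qed

lemmas gf_odd_suffix_step = path_gf_step[where P = "odd_suffix k u g h" for u g h, OF finite_levels_step(1)]
lemmas gf_no_initial_NSE_step = path_gf_step[where P = "\<lambda>ss. odd_suffix k u g h ss \<and> no_initial_NSE ss" for u g h, OF finite_levels_step(2)]

lemmas gf_simps = step_gf_def path_gf_False

lemma gf_odd_suffix_0: "u \<in> {NEstep, Nstep} \<or> h = 0 \<and> u = Estep \<Longrightarrow> path_gf u (odd_suffix k u g h) 0 = 0"
  by (rule path_gf_eq_0) (use odd_suffix_num_peaks_pos in auto)

text \<open>The only path without peaks is the straight descent.\<close>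

lemma gfA_0: "gfA g h 0 = 1"
proof (induction h arbitrary: g)
  case 0
  show ?case by (subst gf_odd_suffix_step) (cases g; cases "Suc 0 < k"; simp add: gf_simps gf_odd_suffix_0)
next
  case (Suc h)
  then show ?case by (subst gf_odd_suffix_step) (cases g; cases "Suc (Suc h) < k"; simp add: gf_simps gf_odd_suffix_0)
qed

text \<open>A preceding E or SE step makes a difference only for the empty list, which has no
  peaks.\<close>

lemma gfE_eq: "gfE g (Suc N) = gfA g 0 (Suc N)"
proof -
  have "odd_suffix k Estep g 0 ss \<and> num_peaks Estep ss = Suc N \<and> maj Estep ss = n \<longleftrightarrow>
     odd_suffix k SEstep g 0 ss \<and> num_peaks SEstep ss = Suc N \<and> maj SEstep ss = n" for ss n
  proof (cases ss)
    case (Cons s ss')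
    then show ?thesis by (cases s) auto
  qed auto
  then show ?thesis by (simp add: path_gf_def)
qed

text \<open>At an odd position no ascent may begin, so the next step is SE, or E at height 0;
  truncated subtraction covers both.\<close>

lemma gfA_False: "gfA False h N = fps_X ^ N * gfA True (h - 1) N"
proof (cases N)
  case 0
  then show ?thesis by (simp add: gfA_0)
next
  case (Suc N')
  then show ?thesis by (subst gf_odd_suffix_step) (cases "h = 0"; simp add: gf_simps gfE_eq)
qed

lemma gfN: "gfN g (Suc h) (Suc N) = fps_X ^ N * gfA (\<not> g) h N"
  by (subst gf_odd_suffix_step) (simp add: gf_simps)

lemma gfU: "gfU g (Suc h) (Suc N) = fps_X ^ N * gfA (\<not> g) h N
    + (if Suc (Suc h) < k then fps_X ^ Suc N * gfU (\<not> g) (Suc (Suc h)) (Suc N) + gfN (\<not> g) (Suc (Suc h)) (Suc N) else 0)"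
  by (subst gf_odd_suffix_step) (simp add: gf_simps)

lemma gfV: "gfV g (Suc h) (Suc N) = fps_X ^ N * gfA (\<not> g) h N
    + (if Suc (Suc h) < k then fps_X ^ Suc N * gfV (\<not> g) (Suc (Suc h)) (Suc N) else 0)"
  by (subst gf_no_initial_NSE_step) (simp add: gf_simps)

text \<open>The left side counts ascents from height h, including their first step, up to an
  arbitrary first peak. Those ending in an NESE peak give q^(N+1) times \<open>gfV\<close>.
  Replacing the last NE step of the ascent by a north step moves all N + 1 peaks one unit to the
  left, so those ending in an NSE peak give \<open>gfV\<close> itself.\<close>

lemma gfU_gfV:
  "h < k \<Longrightarrow> fps_X ^ Suc N * gfU g (Suc h) (Suc N) + gfN g (Suc h) (Suc N)
    = (1 + fps_X ^ Suc N) * gfV g (Suc h) (Suc N)"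
proof (induction "k - h" arbitrary: h g rule: less_induct)
  case less
  show ?case
  proof (cases "Suc (Suc h) < k")
    case True
    then show ?thesis using less(1)[of "Suc h" "\<not> g"]
      by (simp add: gfU[of g h] gfV[of g h] gfN[of g h] distrib_left distrib_right mult.left_commute
          del: power_Suc)
  next
    case False
    then show ?thesis
      by (simp add: gfU[of g h] gfV[of g h] gfN[of g h] algebra_simps)
  qed
qed

text \<open>A path at an even position either begins an ascent or takes a down step; the latter
  leads to an odd position and thus forces a second one. This is why heights change in steps of
  two.\<close>

lemma gfA_True:
  "gfA True h (Suc N) = fps_X ^ (2 * Suc N) * gfA True (h - 2) (Suc N)
    + (if Suc h < k then (1 + fps_X ^ Suc N) * gfV False (Suc h) (Suc N) else 0)"
proof -
  have "gfA True h (Suc N) = fps_X ^ Suc N * gfA False (h - 1) (Suc N)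
    + (if Suc h < k then fps_X ^ Suc N * gfU False (Suc h) (Suc N) + gfN False (Suc h) (Suc N) else 0)"
    by (subst gf_odd_suffix_step) (cases "h = 0"; simp add: gf_simps gfE_eq)
  also have "fps_X ^ Suc N * gfA False (h - 1) (Suc N) = fps_X ^ (2 * Suc N) * gfA True (h - 2) (Suc N)"
    by (simp add: gfA_False numeral_2_eq_2 power_add mult.assoc diff_diff_add)
  finally show ?thesis by (simp add: gfU_gfV del: power_Suc)
qed

text \<open>As for \<open>gfA_True\<close>, except that an opening ascent must end in an NESE peak,
  so its factor is q^(N+1) instead of 1 + q^(N+1).\<close>

lemma gfJ_Suc:
  "gfJ h (Suc N) = fps_X ^ (2 * Suc N) * gfA True (h - 2) (Suc N)
    + (if Suc h < k then fps_X ^ Suc N * gfV False (Suc h) (Suc N) else 0)"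
proof -
  have "gfJ h (Suc N) = fps_X ^ Suc N * gfA False (h - 1) (Suc N)
    + (if Suc h < k then fps_X ^ Suc N * gfV False (Suc h) (Suc N) else 0)"
    by (subst gf_no_initial_NSE_step) (cases "h = 0"; simp add: gf_simps gfE_eq)
  also have "fps_X ^ Suc N * gfA False (h - 1) (Suc N) = fps_X ^ (2 * Suc N) * gfA True (h - 2) (Suc N)"
    by (simp add: gfA_False numeral_2_eq_2 power_add mult.assoc diff_diff_add)
  finally show ?thesis .
qed

text \<open>The ascent peaks at once, peaks one step later, or continues by two. In the second case
  the exponent is (N + 1) + N + N: the additional NE step, the SE step of the peak, and a forced
  further down step that returns to height h. So the first two cases involve the same
  series.\<close>

lemma gfV_double:
  assumes "Suc h < k"
  shows "gfV False (Suc h) (Suc N) = fps_X ^ N * gfA True h N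
   + (if Suc (Suc h) < k then fps_X ^ (3 * N + 1) * gfA True h N
      + (if Suc (Suc (Suc h)) < k then fps_X ^ (2 * Suc N) * gfV False (Suc (Suc (Suc h))) (Suc N) else 0) else 0)"
  by (simp add: gfV[of _ h] gfV[of _ "Suc h"] gfA_False power_add mult.assoc algebra_simps
       numeral_3_eq_3 numeral_2_eq_2)

lemma gfJ_0: "gfJ h 0 = 1"
proof -
  have e: "path_gf NEstep (\<lambda>ss. odd_suffix k NEstep g' h' ss \<and> Q ss) 0 = 0" for g' h' Q
    by (rule path_gf_eq_0) (use odd_suffix_num_peaks_pos in auto)
  show ?thesis
    by (subst gf_no_initial_NSE_step) (cases "h = 0"; cases "Suc h < k"; simp add: gf_simps gf_odd_suffix_0 gfA_0 e)
qed

end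

section \<open>Path series expressed by chain sums\<close>

definition peak_factor :: "nat \<Rightarrow> rat fps" where
  "peak_factor N = (\<Prod>i<N. fps_X ^ i * (1 + fps_X ^ Suc i))"

lemma peak_factor_Suc: "peak_factor (Suc N) = peak_factor N * (fps_X ^ N * (1 + fps_X ^ Suc N))"
  by (simp add: peak_factor_def)

lemma one_plus_X_nz: "(1 + fps_X ^ Suc N :: rat fps) \<noteq> 0"
proof
  assume "(1 + fps_X ^ Suc N :: rat fps) = 0"
  then have "fps_nth (1 + fps_X ^ Suc N :: rat fps) 0 = 0" by simp
  then show False by simp
qed

lemma one_minus_X_nz: "(1 - fps_X ^ (2 * Suc N) :: rat fps) \<noteq> 0"
proof
  assume "(1 - fps_X ^ (2 * Suc N) :: rat fps) = 0"
  then have "fps_nth (1 - fps_X ^ (2 * Suc N) :: rat fps) 0 = 0" by simp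
  then show False by simp
qed

text \<open>Downward induction on h: \<open>gfV_double\<close> has the shape of
  \<open>chain_sum_recurrence\<close>, and the induction starts one step below the top with
  \<open>chain_sum_subtop\<close>. The factor 1 + q^(N+1) on the left is the new factor of
  \<open>peak_factor (Suc N)\<close>, so no division occurs.\<close>

lemma gfV_chain_sum:
  assumes A: "\<And>h. h \<le> m \<Longrightarrow> gfA (Suc m) True h N = peak_factor N * chain_sum m h N"
  shows "Suc h \<le> m \<Longrightarrow> (1 + fps_X ^ Suc N) * gfV (Suc m) False (Suc h) (Suc N) =
    peak_factor (Suc N) * (chain_sum m h (Suc N) - fps_X ^ (2 * Suc N) * chain_sum m (h - 2) (Suc N))"
proof (induction "m - h" arbitrary: h rule: less_induct)
  case less
  let ?X = "fps_X :: rat fps"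
  let ?Y = "1 + ?X ^ Suc N"
  have hm: "h \<le> m" using less.prems by simp
  show ?case
  proof (cases "Suc (Suc h) \<le> m")
    case False
    then have m: "m = Suc h" using less.prems by simp
    have "?Y * gfV (Suc m) False (Suc h) (Suc N) = ?Y * (?X ^ N * (peak_factor N * chain_sum m h N))"
      using less.prems False by (simp add: gfV_double A[OF hm])
    also have "\<dots> = peak_factor (Suc N) * chain_sum m h N"
      by (simp add: peak_factor_Suc mult.assoc mult.left_commute)
    finally show ?thesis using chain_sum_subtop[of h N] by (simp add: m)
  next
    case True
    have V: "?Y * gfV (Suc m) False (Suc h) (Suc N) =
      ?Y * (?X ^ N * (peak_factor N * chain_sum m h N)) + ?Y * (?X ^ (3 * N + 1) * (peak_factor N * chain_sum m h N))
      + ?X ^ (2 * Suc N) * (peak_factor (Suc N) * (chain_sum m (h + 2) (Suc N) - ?X ^ (2 * Suc N) * chain_sum m h (Suc N)))"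
    proof (cases "Suc (Suc (Suc h)) \<le> m")
      case T: True
      have IH: "?Y * gfV (Suc m) False (Suc (h + 2)) (Suc N) =
         peak_factor (Suc N) * (chain_sum m (h + 2) (Suc N) - ?X ^ (2 * Suc N) * chain_sum m h (Suc N))"
        using less.hyps[of "h + 2"] T by simp
      have "gfV (Suc m) False (Suc h) (Suc N) = ?X ^ N * (peak_factor N * chain_sum m h N) + ?X ^ (3 * N + 1) * (peak_factor N * chain_sum m h N)
         + ?X ^ (2 * Suc N) * gfV (Suc m) False (Suc (h + 2)) (Suc N)"
        using gfV_double[of h "Suc m" N] T A[OF hm] by (simp add: add.assoc)
      then have "?Y * gfV (Suc m) False (Suc h) (Suc N) =
          ?Y * (?X ^ N * (peak_factor N * chain_sum m h N)) + ?Y * (?X ^ (3 * N + 1) * (peak_factor N * chain_sum m h N))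
         + ?X ^ (2 * Suc N) * (?Y * gfV (Suc m) False (Suc (h + 2)) (Suc N))"
        by (simp only: distrib_left mult.left_commute)
      then show ?thesis unfolding IH .
    next
      case F: False
      then have m: "m = h + 2" using True by simp
      \<comment> \<open>The ascent cannot continue by two steps here; accordingly the difference for
        h + 2 is zero, and the formula keeps its general form.\<close>
      have 0: "chain_sum m (h + 2) (Suc N) - ?X ^ (2 * Suc N) * chain_sum m h (Suc N) = 0"
        using chain_sum_top[of m "Suc N"] by (simp add: m)
      have "gfV (Suc m) False (Suc h) (Suc N) = ?X ^ N * (peak_factor N * chain_sum m h N) + ?X ^ (3 * N + 1) * (peak_factor N * chain_sum m h N)"
        using gfV_double[of h "Suc m" N] m A[OF hm] by simp
      then show ?thesis unfolding 0 by (simp only: distrib_left mult_zero_right add_0_right)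
    qed
    also have "\<dots> = peak_factor (Suc N) * (?X ^ (2 * Suc N) * (chain_sum m (h + 2) (Suc N) - ?X ^ (2 * Suc N) * chain_sum m h (Suc N))
      + (1 + ?X ^ (2 * N + 1)) * chain_sum m h N)"
    proof -
      have "?X ^ (3 * N + 1) = ?X ^ N * ?X ^ (2 * N + 1)" by (simp flip: power_add)
      show ?thesis unfolding peak_factor_Suc \<open>?X ^ (3 * N + 1) = _\<close> by algebra
    qed
    finally show ?thesis using chain_sum_recurrence[of h m N] True by simp
  qed
qed

text \<open>\<open>peak_factor N\<close> is q^(N(N-1)/2) (-q;q)_N. For N + 1 peaks, the hypothesis
  for N determines the ascents, after which both sides satisfy the same recurrence from h - 2 to
  h.\<close>

lemma gfA_chain_sum: "h \<le> m \<Longrightarrow> gfA (Suc m) True h N = peak_factor N * chain_sum m h N"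
proof (induction N arbitrary: h)
  case 0
  show ?case by (simp add: gfA_0 chain_sum_at_0 peak_factor_def)
next
  case (Suc N)
  let ?X = "fps_X :: rat fps"
  have step: "gfA (Suc m) True h (Suc N) = ?X ^ (2 * Suc N) * gfA (Suc m) True (h - 2) (Suc N)
    + peak_factor (Suc N) * (chain_sum m h (Suc N) - ?X ^ (2 * Suc N) * chain_sum m (h - 2) (Suc N))" if "h \<le> m" for h
  proof (cases "h = m")
    case True
    have "chain_sum m h (Suc N) - ?X ^ (2 * Suc N) * chain_sum m (h - 2) (Suc N) = 0"
      using chain_sum_top[of m "Suc N"] True by simp
    then show ?thesis using True by (subst gfA_True) simp
  next
    case False
    then have h: "Suc h \<le> m" using that by simp
    show ?thesis
      using h gfV_chain_sum[OF Suc.IH h] by (subst gfA_True) (simp del: power_Suc)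
  qed
  from Suc.prems show ?case
  proof (induction h rule: less_induct)
    case (less h)
    show ?case
    proof (cases "h = 0")
      case True
      \<comment> \<open>Since 0 - 2 = 0, the recurrence at height 0 is a linear equation for the
        value itself, with the nonzero coefficient 1 - q^(2(N+1)).\<close>
      have "(1 - ?X ^ (2 * Suc N)) * gfA (Suc m) True 0 (Suc N) =
         (1 - ?X ^ (2 * Suc N)) * (peak_factor (Suc N) * chain_sum m 0 (Suc N))"
        using step[of 0] by (simp add: algebra_simps)
      then show ?thesis using one_minus_X_nz[of N] True by (simp only: mult_cancel_left simp_thms)
    next
      case False
      then have "gfA (Suc m) True (h - 2) (Suc N) = peak_factor (Suc N) * chain_sum m (h - 2) (Suc N)"
        using less by simp
      then show ?thesis using step[OF less.prems] by (simp add: algebra_simps)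
    qed
  qed
qed

text \<open>Multiplied by 1 + q^(N+1), the two openings combine and the terms in q^(3(N+1)) cancel.
  Dividing again costs one factor of (-q)_{N+1}, which explains the index N_1 - 1. The two chain
  sums left are the parts with and without q^(2 N_a).\<close>

lemma gfJ_chain_sum:
  assumes h: "h \<le> m"
  shows "gfJ (Suc m) h (Suc N) = fps_X ^ (2 * N + 1) * peak_factor N * (chain_sum m h (Suc N) + fps_X ^ Suc N * chain_sum m (h - 2) (Suc N))"
proof -
  let ?X = "fps_X :: rat fps"
  let ?Y = "1 + ?X ^ Suc N"
  have A: "gfA (Suc m) True (h - 2) (Suc N) = peak_factor (Suc N) * chain_sum m (h - 2) (Suc N)"
    using h by (intro gfA_chain_sum) simp
  have V: "?Y * (if Suc h < Suc m then ?X ^ Suc N * gfV (Suc m) False (Suc h) (Suc N) else 0)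
    = ?X ^ Suc N * (peak_factor (Suc N) * (chain_sum m h (Suc N) - ?X ^ (2 * Suc N) * chain_sum m (h - 2) (Suc N)))"
  proof (cases "h = m")
    case True
    have "chain_sum m h (Suc N) - ?X ^ (2 * Suc N) * chain_sum m (h - 2) (Suc N) = 0"
      using chain_sum_top[of m "Suc N"] True by simp
    then show ?thesis using True by simp
  next
    case False
    then have h': "Suc h \<le> m" using h by simp
    have "?Y * (?X ^ Suc N * gfV (Suc m) False (Suc h) (Suc N)) = ?X ^ Suc N * (?Y * gfV (Suc m) False (Suc h) (Suc N))"
      by (rule mult.left_commute)
    then show ?thesis using h' gfV_chain_sum[OF gfA_chain_sum h'] by (simp del: power_Suc)
  qed
  have "?Y * gfJ (Suc m) h (Suc N) = ?Y * (?X ^ (2 * Suc N) * (peak_factor (Suc N) * chain_sum m (h - 2) (Suc N)))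
    + ?X ^ Suc N * (peak_factor (Suc N) * (chain_sum m h (Suc N) - ?X ^ (2 * Suc N) * chain_sum m (h - 2) (Suc N)))"
    unfolding gfJ_Suc A distrib_left V ..
  also have "\<dots> = ?Y * (?X ^ (2 * N + 1) * peak_factor N * (chain_sum m h (Suc N) + ?X ^ Suc N * chain_sum m (h - 2) (Suc N)))"
  proof -
    have 1: "?X ^ (2 * Suc N) = ?X ^ Suc N * ?X ^ Suc N" by (simp flip: power_add add: mult_2)
    have 2: "?X ^ (2 * N + 1) = ?X ^ N * ?X ^ Suc N" by (simp flip: power_add add: mult_2)
    show ?thesis unfolding peak_factor_Suc 1 2 by algebra
  qed
  finally show ?thesis using one_plus_X_nz[of N] by (simp only: mult_cancel_left simp_thms)
qed

lemma peak_factor_eq: "fps_X ^ (2 * N + 1) * peak_factor N =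
  fps_X ^ (Suc N * (Suc N + 1) div 2) * qpoch (- fps_X) fps_X (int (Suc N) - 1)"
proof -
  have e: "(\<Prod>i<N. fps_X ^ i :: rat fps) = fps_X ^ (N * (N - 1) div 2)" for N
  proof (induction N)
    case (Suc N)
    have "N * (N - 1) div 2 + N = Suc N * (Suc N - 1) div 2"
      by (cases N) auto
    then show ?case using Suc by (simp flip: power_add)
  qed simp
  have "2 * N + 1 + N * (N - 1) div 2 = Suc N * (Suc N + 1) div 2"
    by (cases N) auto
  moreover have "peak_factor N = fps_X ^ (N * (N - 1) div 2) * (\<Prod>i<N. 1 + fps_X * fps_X ^ i)"
    by (simp add: peak_factor_def prod.distrib e)
  ultimately show ?thesis by (simp add: qpoch_def flip: mult.assoc power_add)
qed

section \<open>The multiple sum, grouped by N_1\<close>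

definition tuples :: "nat \<Rightarrow> nat \<Rightarrow> nat \<Rightarrow> (nat \<Rightarrow> nat) set" where
  "tuples k b M = {ns \<in> {b..<k} \<rightarrow>\<^sub>E UNIV. partial_sum_N k ns b = M}"

definition lin_exponent :: "nat \<Rightarrow> nat \<Rightarrow> (nat \<Rightarrow> nat) \<Rightarrow> nat" where
  "lin_exponent k a N = (\<Sum>j | a + 2 * j < k. 2 * N (a + 2 * j))"

text \<open>The square of N_b is left out: for b = 1 a triangular number stands in its place, and
  for larger b it is supplied by the passage from b - 1 to b. The linear exponent starts at N_a, so
  the one in the theorem belongs to a + 2.\<close>

definition summand :: "nat \<Rightarrow> nat \<Rightarrow> nat \<Rightarrow> (nat \<Rightarrow> nat) \<Rightarrow> rat fps" where
  "summand b k a ns =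
    fps_X ^ ((\<Sum>i\<in>{Suc b..<k}. (partial_sum_N k ns i)\<^sup>2) + lin_exponent k a (partial_sum_N k ns))
    * (\<Prod>i\<in>{b..<k}. inv_Qfac (ns i))"

lemma finite_lin_exponent: "finite {j. a + 2 * j < (k::nat)}"
  by (rule finite_subset[of _ "{..k}"]) auto

lemma partial_sum_N_Suc: "b < k \<Longrightarrow> partial_sum_N k ns b = ns b + partial_sum_N k ns (Suc b)"
  by (simp add: partial_sum_N_def sum.atLeast_Suc_lessThan)

lemma partial_sum_N_ge: "k \<le> b \<Longrightarrow> partial_sum_N k ns b = 0"
  by (simp add: partial_sum_N_def)

lemma partial_sum_N_upd: "b < i \<Longrightarrow> partial_sum_N k (ns(b := x)) i = partial_sum_N k ns i"
  by (simp add: partial_sum_N_def)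

lemma lin_exponent_plus_2: "lin_exponent k (a + 2) N = (\<Sum>j | 1 \<le> j \<and> a + 2 * j < k. 2 * N (a + 2 * j))"
  unfolding lin_exponent_def
  by (rule sum.reindex_bij_witness[of _ "\<lambda>j. j - 1" Suc]) auto

lemma lin_exponent_Suc:
  assumes "a < k"
  shows "lin_exponent k a N = 2 * N a + lin_exponent k (a + 2) N"
proof -
  have "{j. a + 2 * j < k} = insert 0 {j. 1 \<le> j \<and> a + 2 * j < k}"
    using assms by auto
  moreover have "finite {j. 1 \<le> j \<and> a + 2 * j < k}"
    by (rule finite_subset[OF _ finite_lin_exponent]) auto
  ultimately have "lin_exponent k a N = 2 * N a + (\<Sum>j | 1 \<le> j \<and> a + 2 * j < k. 2 * N (a + 2 * j))"
    unfolding lin_exponent_def by simp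
  then show ?thesis unfolding lin_exponent_plus_2 .
qed

lemma lin_exponent_cong: "(\<And>i. a \<le> i \<Longrightarrow> N i = N' i) \<Longrightarrow> lin_exponent k a N = lin_exponent k a N'"
  by (simp add: lin_exponent_def)

lemma finite_tuples: "finite (tuples k b M)"
proof (rule finite_subset)
  show "tuples k b M \<subseteq> {b..<k} \<rightarrow>\<^sub>E {..M}"
  proof
    fix ns assume ns: "ns \<in> tuples k b M"
    have "ns i \<le> M" if "i \<in> {b..<k}" for i
      using ns that member_le_sum[of i "{b..<k}" ns] by (auto simp: tuples_def partial_sum_N_def)
    then show "ns \<in> {b..<k} \<rightarrow>\<^sub>E {..M}" using ns by (auto simp: tuples_def PiE_def)
  qed
qed (auto intro!: finite_PiE)

lemma sum_tuples_Suc: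
  assumes b: "b < k"
  shows "(\<Sum>ns\<in>tuples k b M. f ns) = (\<Sum>M'\<le>M. \<Sum>ns\<in>tuples k (Suc b) M'. f (ns(b := M - M')))"
proof -
  have "(\<Sum>M'\<le>M. \<Sum>ns\<in>tuples k (Suc b) M'. f (ns(b := M - M'))) =
    (\<Sum>(M', ns)\<in>Sigma {..M} (tuples k (Suc b)). f (ns(b := M - M')))"
    by (rule sum.Sigma) (auto simp: finite_tuples)
  also have "\<dots> = (\<Sum>ns\<in>tuples k b M. f ns)"
  \<comment> \<open>Here M' is N_(b+1) and n_b = M - M'. Resetting the value at b to
    \<open>undefined\<close> makes the shorter tuple extensional again.\<close>
  proof (rule sum.reindex_bij_witness[of _ "\<lambda>ns. (partial_sum_N k ns (Suc b), ns(b := undefined))"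
      "\<lambda>(M', ns). ns(b := M - M')"], goal_cases)
    case (1 p)
    then obtain M' ns where p: "p = (M', ns)" "M' \<le> M" "ns \<in> tuples k (Suc b) M'" by auto
    then have "ns b = undefined" by (auto simp: tuples_def PiE_def extensional_def)
    then show ?case using p by (auto simp: tuples_def partial_sum_N_upd)
  next
    case (2 p)
    then obtain M' ns where p: "p = (M', ns)" "M' \<le> M" "ns \<in> tuples k (Suc b) M'" by auto
    then show ?case using b
      by (auto simp: tuples_def partial_sum_N_upd partial_sum_N_Suc[OF b] PiE_def extensional_def)
  next
    case (3 ns)
    then show ?case using b by (auto simp: tuples_def partial_sum_N_Suc[OF b])
  next
    case (4 ns)
    then show ?case using b
      by (auto simp: tuples_def partial_sum_N_upd partial_sum_N_Suc[OF b] PiE_def extensional_def)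
  qed auto
  finally show ?thesis ..
qed

lemma summand_upd:
  assumes "b < k" "b \<le> a" "ns \<in> tuples k (Suc b) M'" "M' \<le> M"
  shows "summand b k a (ns(b := M - M')) = (if a = b
    then fps_X ^ (2 * M) * (fps_X ^ M'\<^sup>2 * summand (Suc b) k (a + 2) ns)
    else fps_X ^ M'\<^sup>2 * summand (Suc b) k a ns) * inv_Qfac (M - M')"
proof -
  let ?N = "partial_sum_N k ns" and ?N' = "partial_sum_N k (ns(b := M - M'))"
  have M': "?N (Suc b) = M'" using assms(3) by (simp add: tuples_def)
  have N': "?N' i = ?N i" if "b < i" for i using that by (rule partial_sum_N_upd)
  have M: "?N' b = M" using partial_sum_N_Suc[OF assms(1)] N' M' assms(4) by simp
  have sq: "(\<Sum>i\<in>{Suc b..<k}. (?N' i)\<^sup>2) = M'\<^sup>2 + (\<Sum>i\<in>{Suc (Suc b)..<k}. (?N i)\<^sup>2)"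
  proof (cases "Suc b < k")
    case True
    then show ?thesis by (simp add: sum.atLeast_Suc_lessThan[of "Suc b"] N' M')
  next
    case False
    then show ?thesis using M' partial_sum_N_ge[of k "Suc b" ns] by simp
  qed
  have pr: "(\<Prod>i\<in>{b..<k}. inv_Qfac ((ns(b := M - M')) i)) = inv_Qfac (M - M') * (\<Prod>i\<in>{Suc b..<k}. inv_Qfac (ns i))"
    using assms(1) by (simp add: prod.atLeast_Suc_lessThan)
  have li: "lin_exponent k a ?N' = (if a = b then 2 * M + lin_exponent k (a + 2) ?N else lin_exponent k a ?N)"
  proof (cases "a = b")
    case True
    have "lin_exponent k (a + 2) ?N' = lin_exponent k (a + 2) ?N" using True N' by (intro lin_exponent_cong) simp
    then show ?thesis using True lin_exponent_Suc[of a k ?N'] assms(1) M by simp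
  next
    case False
    then show ?thesis using assms(2) N' by (auto intro!: lin_exponent_cong)
  qed
  show ?thesis unfolding summand_def sq pr li
    by (simp add: power_add algebra_simps)
qed

text \<open>The recursion replaces a by a + 2 and may pass k; then k - a truncates to 0 and the
  linear exponent is empty. The condition h = \<open>Suc m\<close> in \<open>chain_sum\<close> says
  a = b.\<close>

lemma sum_summand:
  "b \<le> k \<Longrightarrow> b \<le> a \<Longrightarrow> (\<Sum>ns\<in>tuples k b M. summand b k a ns) = chain_sum (k - b) (k - a) M"
proof (induction "k - b" arbitrary: b a M)
  case 0
  then have b: "b = k" by simp
  have "tuples k b M = (if M = 0 then {\<lambda>_. undefined} else {})"
    by (auto simp: tuples_def b partial_sum_N_def)
  moreover have "{j. a + 2 * j < k} = {}" using 0 b by auto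
  ultimately show ?case by (simp add: b summand_def lin_exponent_def)
next
  case (Suc m)
  then have b: "b < k" by simp
  have m: "k - b = Suc m" "k - Suc b = m" using Suc(2) by auto
  have IH: "(\<Sum>ns\<in>tuples k (Suc b) M'. summand (Suc b) k a' ns) = chain_sum m (k - a') M'" if "Suc b \<le> a'" for a' M'
    using Suc(1)[of "Suc b" a' M'] m b that by simp
  have "(\<Sum>ns\<in>tuples k b M. summand b k a ns) =
     (\<Sum>M'\<le>M. \<Sum>ns\<in>tuples k (Suc b) M'. summand b k a (ns(b := M - M')))"
    by (rule sum_tuples_Suc[OF b])
  also have "\<dots> = (\<Sum>M'\<le>M. (if k - a = Suc m then fps_X ^ (2 * M) * (fps_X ^ M'\<^sup>2 * chain_sum m (k - a - 2) M')
      else fps_X ^ M'\<^sup>2 * chain_sum m (k - a) M') * inv_Qfac (M - M'))"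
  proof (rule sum.cong[OF refl])
    fix M' assume "M' \<in> {..M}"
    then have "M' \<le> M" by simp
    have "(\<Sum>ns\<in>tuples k (Suc b) M'. summand b k a (ns(b := M - M'))) =
      (\<Sum>ns\<in>tuples k (Suc b) M'. (if a = b
        then fps_X ^ (2 * M) * (fps_X ^ M'\<^sup>2 * summand (Suc b) k (a + 2) ns)
        else fps_X ^ M'\<^sup>2 * summand (Suc b) k a ns) * inv_Qfac (M - M'))"
      by (rule sum.cong[OF refl]) (rule summand_upd[OF b Suc.prems(2) _ \<open>M' \<le> M\<close>])
    also have "\<dots> = (if a = b then fps_X ^ (2 * M) * (fps_X ^ M'\<^sup>2 * chain_sum m (k - (a + 2)) M')
      else fps_X ^ M'\<^sup>2 * chain_sum m (k - a) M') * inv_Qfac (M - M')"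
    proof (cases "a = b")
      case True
      then show ?thesis
        using IH[of "a + 2" M'] by (simp flip: sum_distrib_left sum_distrib_right)
    next
      case False
      then show ?thesis
        using Suc.prems(2) IH[of a M'] by (simp flip: sum_distrib_left sum_distrib_right)
    qed
    also have "k - (a + 2) = k - a - 2" by simp
    also have "(a = b) = (k - a = Suc m)" using m b Suc.prems by auto
    finally show "(\<Sum>ns\<in>tuples k (Suc b) M'. summand b k a (ns(b := M - M'))) =
      (if k - a = Suc m then fps_X ^ (2 * M) * (fps_X ^ M'\<^sup>2 * chain_sum m (k - a - 2) M')
      else fps_X ^ M'\<^sup>2 * chain_sum m (k - a) M') * inv_Qfac (M - M')" .
  qed
  finally show ?case by (simp add: m chain_sum.simps(2))
qed

definition full_summand :: "nat \<Rightarrow> nat \<Rightarrow> (nat \<Rightarrow> nat) \<Rightarrow> rat fps" where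
  "full_summand k a ns = (let N = partial_sum_N k ns in
            fps_X ^ (N 1 * (N 1 + 1) div 2 + (\<Sum>i\<in>{2..<k}. (N i)\<^sup>2)
                       + (\<Sum>j | 1 \<le> j \<and> a + 2 * j \<le> k - 1. 2 * N (a + 2 * j)))
            * qpoch (- fps_X) fps_X (int (N 1) - 1)
            * (fps_X ^ N 1 + fps_X ^ (2 * N a))
            / (\<Prod>i\<in>{1..<k}. qpoch (fps_X\<^sup>2) (fps_X\<^sup>2) (int (ns i))))"

text \<open>The denominators have constant term 1, so the division is multiplication by an
  inverse.\<close>

lemma divide_prod_Qfac: "(x :: rat fps) / (\<Prod>i\<in>A. Qfac (ns i)) = x * (\<Prod>i\<in>A. inv_Qfac (ns i))"
proof -
  have 0: "fps_nth (\<Prod>i\<in>A. Qfac (ns i)) 0 = 1"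
    by (induction A rule: infinite_finite_induct) (simp_all add: Qfac_nth_0)
  have "inverse (\<Prod>i\<in>A. Qfac (ns i)) = (\<Prod>i\<in>A. inv_Qfac (ns i))"
    by (induction A rule: infinite_finite_induct) (simp_all add: inv_Qfac_def fps_inverse_mult)
  then show ?thesis using 0 by (simp add: fps_divide_unit)
qed

text \<open>Expanding q^(N_1) + q^(2 N_a) separates two linear exponents: q^(2 N_a) supplies the
  term j = 0, giving parameter a, while the other part keeps a + 2. For a = k both exponents are
  empty and N_k = 0.\<close>

lemma full_summand_eq:
  assumes "1 \<le> a" "a \<le> k" "partial_sum_N k ns 1 = M"
  shows "full_summand k a ns = fps_X ^ (M * (M + 1) div 2) * qpoch (- fps_X) fps_X (int M - 1)
    * (fps_X ^ M * summand 1 k (a + 2) ns + summand 1 k a ns)"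
proof -
  let ?N = "partial_sum_N k ns"
  have l: "(\<Sum>j | 1 \<le> j \<and> a + 2 * j \<le> k - 1. 2 * ?N (a + 2 * j)) = lin_exponent k (a + 2) ?N"
    unfolding lin_exponent_plus_2 using assms by (intro sum.cong) auto
  have la: "lin_exponent k a ?N = 2 * ?N a + lin_exponent k (a + 2) ?N"
  proof (cases "a < k")
    case False
    then have "a = k" using assms by simp
    moreover have "{j. k + 2 * j < k} = {}" "{j. k + 2 + 2 * j < k} = {}" by auto
    ultimately show ?thesis by (simp add: lin_exponent_def partial_sum_N_ge)
  qed (rule lin_exponent_Suc)
  have q: "qpoch (fps_X\<^sup>2) (fps_X\<^sup>2) (int n) = Qfac n" for n
    by (simp add: qpoch_def Qfac_def)
  show ?thesis
    unfolding full_summand_def Let_def l q divide_prod_Qfac assms(3) summand_def la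
    by (simp add: power_add algebra_simps numeral_2_eq_2)
qed

lemma sum_full_summand:
  assumes "1 \<le> a" "a \<le> k"
  shows "(\<Sum>ns\<in>tuples k 1 M. full_summand k a ns) = gfJ k (k - a) M"
proof -
  let ?X = "fps_X :: rat fps"
  let ?e = "?X ^ (M * (M + 1) div 2) * qpoch (- fps_X) fps_X (int M - 1)"
  have k: "1 \<le> k" using assms by simp
  have "(\<Sum>ns\<in>tuples k 1 M. full_summand k a ns) =
     (\<Sum>ns\<in>tuples k 1 M. ?e * (?X ^ M * summand 1 k (a + 2) ns + summand 1 k a ns))"
    by (intro sum.cong[OF refl] full_summand_eq assms) (simp add: tuples_def)
  also have "\<dots> = ?e * (?X ^ M * chain_sum (k - 1) (k - a - 2) M + chain_sum (k - 1) (k - a) M)"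
    using sum_summand[of 1 k a M] sum_summand[of 1 k "a + 2" M] assms k
    by (simp add: sum.distrib flip: sum_distrib_left)
  also have "\<dots> = gfJ k (k - a) M"
  proof (cases M)
    case 0
    \<comment> \<open>For N_1 = 0 the value (-q)_{-1} = 1/2 meets q^0 + q^0 = 2.\<close>
    have "fps_const (1 / 2 :: rat) * (1 + 1) = fps_const (1 / 2) * fps_const 2"
      by (simp only: numeral_fps_const one_add_one)
    also have "\<dots> = 1" by (simp only: fps_const_mult) simp
    finally have "fps_const (1 / 2 :: rat) * (1 + 1) = 1" .
    then show ?thesis by (simp add: 0 chain_sum_at_0 gfJ_0 qpoch_minus_one)
  next
    case (Suc N)
    have "gfJ (Suc (k - 1)) (k - a) (Suc N) = ?X ^ (2 * N + 1) * peak_factor N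
       * (chain_sum (k - 1) (k - a) (Suc N) + ?X ^ Suc N * chain_sum (k - 1) (k - a - 2) (Suc N))"
      using assms by (intro gfJ_chain_sum) simp
    also have "\<dots> = ?e * (?X ^ M * chain_sum (k - 1) (k - a - 2) M + chain_sum (k - 1) (k - a) M)"
      unfolding peak_factor_eq Suc by (simp only: add.commute)
    finally show ?thesis using k by (simp add: Suc)
  qed
  finally show ?thesis .
qed

text \<open>Convergence is coefficientwise: each coefficient of the partial sums is constant once
  they contain a suitable finite set.\<close>

lemma has_sum_full_summand:
  assumes "1 \<le> a" "a \<le> k"
    and J: "\<And>n. J k a n = card {ss. (odd_suffix k SEstep True (k - a) ss \<and> no_initial_NSE ss) \<and> maj SEstep ss = n}"
  shows "(full_summand k a has_sum Abs_fps (\<lambda>n. of_nat (J k a n))) ({1..<k} \<rightarrow>\<^sub>E UNIV)"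
  unfolding has_sum_def
proof (rule tendsto_fpsI)
  fix n
  let ?P = "\<lambda>ss. odd_suffix k SEstep True (k - a) ss \<and> no_initial_NSE ss"
  \<comment> \<open>By \<open>num_peaks_le_maj\<close>, paths of major index n have at most n + 1
    peaks. Tuples with larger N_1 have exponent at least N_1(N_1 + 1)/2 > n.\<close>
  define F0 where "F0 = (\<Union>M\<le>Suc n. tuples k 1 M)"
  have F0: "finite F0" "F0 \<subseteq> {1..<k} \<rightarrow>\<^sub>E UNIV"
    by (auto simp: F0_def finite_tuples) (auto simp: tuples_def)
  have J': "(of_nat (J k a n) :: rat) = fps_nth (sum (full_summand k a) F0) n"
  proof -
    have "{ss. ?P ss \<and> maj SEstep ss = n} = (\<Union>M\<le>Suc n. {ss. ?P ss \<and> num_peaks SEstep ss = M \<and> maj SEstep ss = n})"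
      using num_peaks_le_maj[of SEstep] by auto
    then have "J k a n = card (\<Union>M\<le>Suc n. {ss. ?P ss \<and> num_peaks SEstep ss = M \<and> maj SEstep ss = n})"
      unfolding J by simp
    also have "\<dots> = (\<Sum>M\<le>Suc n. card {ss. ?P ss \<and> num_peaks SEstep ss = M \<and> maj SEstep ss = n})"
      by (rule card_UN_disjoint) (use finite_levels_odd_suffix(1)[of SEstep k True "k - a" no_initial_NSE] in \<open>auto simp: finite_levels_def\<close>)
    finally have "(of_nat (J k a n) :: rat) = (\<Sum>M\<le>Suc n. fps_nth (gfJ k (k - a) M) n)"
      by (simp add: path_gf_def)
    also have "\<dots> = fps_nth (\<Sum>M\<le>Suc n. \<Sum>ns\<in>tuples k 1 M. full_summand k a ns) n"
      by (simp only: sum_full_summand[OF assms(1,2)] fps_sum_nth)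
    also have "(\<Sum>M\<le>Suc n. \<Sum>ns\<in>tuples k 1 M. full_summand k a ns) = sum (full_summand k a) F0"
      unfolding F0_def by (rule sum.UNION_disjoint[symmetric]) (auto simp: finite_tuples, auto simp: tuples_def)
    finally show ?thesis .
  qed
  have zero: "fps_nth (full_summand k a ns) n = 0" if "ns \<in> ({1..<k} \<rightarrow>\<^sub>E UNIV) - F0" for ns
  proof -
    define M where "M = partial_sum_N k ns 1"
    have "n < M"
      using that by (auto simp: F0_def tuples_def M_def not_le)
    moreover have "M \<le> M * (M + 1) div 2"
      by (cases M) auto
    ultimately have "n < M * (M + 1) div 2" by simp
    then show ?thesis
      unfolding full_summand_eq[OF assms(1,2) M_def[symmetric]] by (simp add: fps_X_power_mult_nth mult.assoc)
  qed
  show "\<forall>\<^sub>F F in finite_subsets_at_top ({1..<k} \<rightarrow>\<^sub>E UNIV).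
     fps_nth (sum (full_summand k a) F) n = fps_nth (Abs_fps (\<lambda>n. of_nat (J k a n))) n"
    unfolding eventually_finite_subsets_at_top
  proof (intro exI[of _ F0] conjI allI impI F0)
    fix F assume F: "finite F \<and> F0 \<subseteq> F \<and> F \<subseteq> {1..<k} \<rightarrow>\<^sub>E UNIV"
    have "(\<Sum>ns\<in>F. fps_nth (full_summand k a ns) n) = (\<Sum>ns\<in>F0. fps_nth (full_summand k a ns) n)"
      by (rule sum.mono_neutral_right) (use F zero in auto)
    then show "fps_nth (sum (full_summand k a) F) n = fps_nth (Abs_fps (\<lambda>n. of_nat (J k a n))) n"
      by (simp add: fps_sum_nth J')
  qed
qed

section \<open>Odd peaks and valleys\<close>

abbreviation up :: "step \<Rightarrow> bool" where
  "up s \<equiv> s \<in> {NEstep, Nstep}"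

text \<open>The beginnings of ascents, including those after an E step. Position 0 counts if the
  path starts upwards, in agreement with the virtual SE step before it.\<close>

definition valleys :: "path \<Rightarrow> nat set" where
  "valleys p = {j. j < length (steps p) \<and> up (steps p ! j) \<and> (j = 0 \<or> \<not> up (steps p ! (j - 1)))}"

lemma vertex_Suc:
  "i < length (steps p) \<Longrightarrow> vertex p (Suc i) = vertex p i + displacement (steps p ! i)"
  by (simp add: vertex_def take_Suc_conv_app_nth add.assoc)

lemma height_Suc:
  "i < length (steps p) \<Longrightarrow> height p (Suc i) = height p i + snd (displacement (steps p ! i))"
  by (simp add: height_def vertex_Suc)

lemma weight_Suc:
  "i < length (steps p) \<Longrightarrow> weight p (Suc i) = weight p i + fst (displacement (steps p ! i))"
  by (simp add: weight_def vertex_Suc)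

lemma vertex_0: "vertex p 0 = (0, start_height p)"
  by (simp add: vertex_def)

lemma peaks_iff:
  "i \<in> peaks p \<longleftrightarrow> 0 < i \<and> i < length (steps p) \<and> up (steps p ! (i - 1)) \<and> steps p ! i = SEstep"
  by (auto simp: peaks_def NESE_peaks_def NSE_peaks_def)

text \<open>Leftmost, because the relative height asks earlier peaks to be strictly lower but allows
  later ones of equal height.\<close>

lemma leftmost_max:
  fixes f :: "nat \<Rightarrow> int"
  assumes "a < b"
  obtains P where "a \<le> P" "P < b" "\<And>x. a \<le> x \<Longrightarrow> x < P \<Longrightarrow> f x < f P"
    "\<And>x. a \<le> x \<Longrightarrow> x < b \<Longrightarrow> f x \<le> f P"
proof -
  let ?M = "Max (f ` {a..<b})"
  have "?M \<in> f ` {a..<b}" using assms by (intro Max_in) auto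
  then obtain x0 where x0: "x0 \<in> {a..<b}" "f x0 = ?M" by auto
  define P where "P = (LEAST x. a \<le> x \<and> f x = ?M)"
  have P: "a \<le> P \<and> f P = ?M" unfolding P_def by (rule LeastI[of _ x0]) (use x0 in auto)
  have "P \<le> x0" unfolding P_def by (rule Least_le) (use x0 in auto)
  then have "P < b" using x0 by auto
  have le: "f x \<le> f P" if "a \<le> x" "x < b" for x
    using that P by (auto intro!: Max_ge)
  have "f x < f P" if "a \<le> x" "x < P" for x
  proof -
    have "f x \<noteq> f P"
      using not_less_Least[of x "\<lambda>x. a \<le> x \<and> f x = ?M", folded P_def] that P by auto
    then show ?thesis using le[of x] that \<open>P < b\<close> by auto
  qed
  then show ?thesis using that P le \<open>P < b\<close> by blast
qed

context
  fixes p :: path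
  assumes lp: "lattice_path p"
begin

abbreviation (input) "len \<equiv> length (steps p)"
abbreviation (input) "H \<equiv> height p"
abbreviation (input) "st i \<equiv> steps p ! i"

lemma H_nonneg: "i \<le> len \<Longrightarrow> 0 \<le> H i"
  and H_end: "H len = 0"
  and H_E: "i < len \<Longrightarrow> st i = Estep \<Longrightarrow> H i = 0"
  and N_SE: "i < len \<Longrightarrow> st i = Nstep \<Longrightarrow> Suc i < len \<and> st (Suc i) = SEstep"
  using lp unfolding lattice_path_def by auto

lemma H_up: "i < len \<Longrightarrow> up (st i) \<Longrightarrow> H (Suc i) = H i + 1"
  by (auto simp: height_Suc)

lemma H_SE: "i < len \<Longrightarrow> st i = SEstep \<Longrightarrow> H (Suc i) = H i - 1"
  by (auto simp: height_Suc)

lemma H_step: "i < len \<Longrightarrow> H i - 1 \<le> H (Suc i) \<and> H (Suc i) \<le> H i + 1"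
  by (cases "st i") (auto simp: height_Suc)

lemma up_iff: "i < len \<Longrightarrow> up (st i) \<longleftrightarrow> H i < H (Suc i)"
  by (cases "st i") (auto simp: height_Suc)

lemma SE_iff: "i < len \<Longrightarrow> st i = SEstep \<longleftrightarrow> H (Suc i) < H i"
  by (cases "st i") (auto simp: height_Suc)

text \<open>A discrete intermediate value argument: a step changes the height by at most 1, so the
  last vertex not above b lies exactly at b and is left by an up step.\<close>

lemma last_at_height:
  assumes "H a \<le> b" "b < H i" "a \<le> i" "i \<le> len"
  obtains l where "a \<le> l" "l < i" "H l = b" "up (st l)" "\<And>x. l < x \<Longrightarrow> x \<le> i \<Longrightarrow> b < H x"
proof -
  define l where "l = (GREATEST l. l \<le> i \<and> H l \<le> b)"
  have l: "l \<le> i \<and> H l \<le> b" unfolding l_def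
    by (rule GreatestI_nat[of _ a i]) (use assms in auto)
  have al: "a \<le> l" unfolding l_def
    by (rule Greatest_le_nat[of _ a i]) (use assms in auto)
  have above: "b < H x" if "l < x" "x \<le> i" for x
  proof (rule ccontr)
    assume "\<not> b < H x"
    then have "x \<le> l" unfolding l_def
      by (intro Greatest_le_nat[of _ x i]) (use that in auto)
    then show False using that by simp
  qed
  have li: "l < i" using l assms by (metis le_neq_implies_less linorder_not_less)
  have "b < H (Suc l)" using above[of "Suc l"] li by simp
  then have "H l = b" "up (st l)"
    using H_step[of l] l li assms(4) up_iff[of l] by auto
  then show ?thesis using that al li above by blast
qed

lemma first_at_height:
  assumes "H e \<le> b" "b < H i" "i \<le> e" "e \<le> len"
  obtains m where "i < m" "m \<le> e" "H m = b" "\<And>x. i \<le> x \<Longrightarrow> x < m \<Longrightarrow> b < H x"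
proof -
  define m where "m = (LEAST m. i \<le> m \<and> H m \<le> b)"
  have m: "i \<le> m \<and> H m \<le> b" unfolding m_def
    by (rule LeastI[of _ e]) (use assms in auto)
  have mc: "m \<le> e" unfolding m_def
    by (rule Least_le) (use assms in auto)
  have above: "b < H x" if "i \<le> x" "x < m" for x
    using that not_less_Least[of x "\<lambda>m. i \<le> m \<and> H m \<le> b"] unfolding m_def by auto
  have im: "i < m" using m assms by (metis le_neq_implies_less linorder_not_less)
  then obtain m' where m': "m = Suc m'" by (cases m) auto
  have "b < H m'" using above[of m'] im m' by simp
  then have "H m = b" using H_step[of m'] m m' mc assms(4) by auto
  then show ?thesis using that im mc above by blast
qed

lemma height_parity:
  "i \<le> j \<Longrightarrow> j \<le> len \<Longrightarrow> (\<And>x. i \<le> x \<Longrightarrow> x < j \<Longrightarrow> st x \<noteq> Estep) \<Longrightarrow> even (H j - H i - (int j - int i))"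
proof (induction j rule: dec_induct)
  case (step j)
  have "even (H j - H i - (int j - int i))" using step by auto
  moreover have "st j \<noteq> Estep" using step by auto
  then have "H (Suc j) = H j + 1 \<or> H (Suc j) = H j - 1"
    using step by (cases "st j") (auto simp: height_Suc)
  ultimately show ?case by auto
qed simp

lemma not_E: "x < len \<Longrightarrow> 0 < H x \<Longrightarrow> st x \<noteq> Estep"
  using H_E by force

text \<open>The leftmost maximum of an excursion above v is entered by an up step. It is not left by
  an E step, since it lies above v and v is nonnegative, so it is a peak.\<close>

lemma excursion_peak:
  assumes "Suc j < m" "m \<le> len" "H j = v" "H m = v" and above: "\<And>x. j < x \<Longrightarrow> x < m \<Longrightarrow> v < H x"
  obtains P where "j < P" "P < m" "P \<in> peaks p" "\<And>x. j \<le> x \<Longrightarrow> x < P \<Longrightarrow> H x < H P"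
    "\<And>x. j \<le> x \<Longrightarrow> x \<le> m \<Longrightarrow> H x \<le> H P"
proof -
  obtain P where P: "Suc j \<le> P" "P < m" "\<And>x. Suc j \<le> x \<Longrightarrow> x < P \<Longrightarrow> H x < H P"
    "\<And>x. Suc j \<le> x \<Longrightarrow> x < m \<Longrightarrow> H x \<le> H P"
    using leftmost_max[OF assms(1), of H] by blast
  have v: "v < H P" using above P by simp
  have l: "H x < H P" if "j \<le> x" "x < P" for x
    using that P(3)[of x] v assms(3) by (cases "x = j") auto
  have r: "H x \<le> H P" if "j \<le> x" "x \<le> m" for x
    using that P(4)[of x] v assms(3,4) by (cases "x = j"; cases "x = m") auto
  obtain P' where P': "P = Suc P'" using P(1) by (cases P) auto
  have "up (st P')" using up_iff[of P'] l[of P'] P P' assms(2) by auto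
  moreover have "st P = SEstep"
  proof -
    have "\<not> up (st P)" using up_iff[of P] r[of "Suc P"] P assms(2) by auto
    moreover have "0 \<le> v" using H_nonneg[of m] assms by simp
    then have "st P \<noteq> Estep" using not_E[of P] v P assms(2) by auto
    ultimately show ?thesis by (cases "st P") auto
  qed
  ultimately have "P \<in> peaks p" using P P' assms(2) by (auto simp: peaks_iff)
  then show ?thesis using P(1,2) l r by (intro that[of P]) auto
qed

lemma weight_mono: "i \<le> j \<Longrightarrow> j \<le> len \<Longrightarrow> weight p i \<le> weight p j"
proof (induction j rule: dec_induct)
  case (step j)
  then show ?case by (cases "st j") (auto simp: weight_Suc)
qed simp

lemma peak_weight_less:
  assumes "i \<in> peaks p" "i < j" "j \<le> len"
  shows "weight p i < weight p j"
proof -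
  have "weight p i < weight p (Suc i)" using assms by (auto simp: peaks_iff weight_Suc)
  also have "\<dots> \<le> weight p j" using assms by (intro weight_mono) auto
  finally show ?thesis .
qed

text \<open>
  The positions \<open>l\<close> and \<open>m\<close> are admissible in the definition of the relative height of the peak \<open>i\<close>,
  with weights replaced by positions.
\<close>

definition saddle :: "nat \<Rightarrow> nat \<Rightarrow> nat \<Rightarrow> bool" where
  "saddle i l m \<longleftrightarrow> l \<le> i \<and> i < m \<and> m \<le> len \<and> H l = H m \<and>
     (\<forall>j\<in>peaks p. l \<le> j \<and> j < i \<longrightarrow> H j < H i) \<and>
     (\<forall>j\<in>peaks p. i < j \<and> j \<le> m \<longrightarrow> H j \<le> H i)"

text \<open>The SE step after a peak makes all later abscissas strictly larger, so comparing
  abscissas with that of a peak is the same as comparing positions.\<close>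

lemma relative_height_eq:
  assumes i: "i \<in> peaks p"
  shows "relative_height p i = (GREATEST h. \<exists>l m. saddle i l m \<and> H l = H i - h)"
proof -
  have in_n: "i < len" using i by (simp add: peaks_iff)
  have wl: "weight p l \<le> weight p i \<longleftrightarrow> l \<le> i" if "l \<le> len" for l
    using that weight_mono[of l i] peak_weight_less[OF i, of l] in_n by force
  have wj: "j < i \<longleftrightarrow> weight p j < weight p i" if "j \<in> peaks p" for j
    using that peak_weight_less[of j i] weight_mono[of i j] in_n by (force simp: peaks_iff not_less)
  have "(\<exists>l\<le>len. \<exists>m\<le>len. H l = H i - h \<and> H m = H i - h \<and> weight p l \<le> weight p i \<and> weight p i < weight p m \<and>
     (\<forall>j\<in>peaks p. l \<le> j \<and> j \<le> m \<longrightarrow> \<not> H j > H i \<and> (H j = H i \<longrightarrow> weight p j \<ge> weight p i)))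
    \<longleftrightarrow> (\<exists>l m. saddle i l m \<and> H l = H i - h)" (is "?L \<longleftrightarrow> ?R") for h
  proof
    assume ?L
    then obtain l m where lm: "l \<le> len" "m \<le> len" "H l = H i - h" "H m = H i - h"
      "weight p l \<le> weight p i" "weight p i < weight p m"
      "\<And>j. j \<in> peaks p \<Longrightarrow> l \<le> j \<Longrightarrow> j \<le> m \<Longrightarrow> H j \<le> H i \<and> (H j = H i \<longrightarrow> weight p j \<ge> weight p i)"
      by (auto simp: not_less)
    have li: "l \<le> i" "i < m" using lm wl[of l] wl[of m] by auto
    have "H j < H i" if "j \<in> peaks p" "l \<le> j" "j < i" for j
      using lm(7)[of j] that li wj[of j] by force
    then have "saddle i l m" using lm li by (auto simp: saddle_def)
    then show ?R using lm by blast
  next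
    assume ?R
    then obtain l m where lm: "saddle i l m" "H l = H i - h" by blast
    have "H j \<le> H i \<and> (H j = H i \<longrightarrow> weight p j \<ge> weight p i)" if "j \<in> peaks p" "l \<le> j" "j \<le> m" for j
      using lm that wj[of j] by (cases j i rule: linorder_cases) (force simp: saddle_def)+
    moreover have "l \<le> len" "m \<le> len" "weight p l \<le> weight p i" "weight p i < weight p m"
      using lm wl[of l] wl[of m] in_n by (auto simp: saddle_def)
    ultimately show ?L using lm by (intro exI[of _ l] exI[of _ m] conjI) (auto simp: saddle_def not_less)
  qed
  then show ?thesis unfolding relative_height_def by simp
qed

lemma relative_height_eqI:
  assumes "i \<in> peaks p" "saddle i l m"
    and "\<And>l' m'. saddle i l' m' \<Longrightarrow> H l \<le> H l'"
  shows "relative_height p i = H i - H l"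
  unfolding relative_height_eq[OF assms(1)]
proof (rule Greatest_equality)
  show "\<exists>l' m. saddle i l' m \<and> H l' = H i - (H i - H l)" using assms(2) by auto
  fix y assume "\<exists>l m. saddle i l m \<and> H l = H i - y"
  then show "y \<le> H i - H l" using assms(3) by force
qed

text \<open>The neighbours i - 1 and i + 1 form a saddle and heights are nonnegative, so a lowest
  saddle exists and the \<open>GREATEST\<close> in the definition is attained.\<close>

lemma relative_height_saddle:
  assumes i: "i \<in> peaks p"
  obtains l m where "saddle i l m" "relative_height p i = H i - H l" "H l < H i"
    "\<And>l' m'. saddle i l' m' \<Longrightarrow> H l \<le> H l'"
proof -
  have i': "0 < i" "i < len" "up (st (i - 1))" "st i = SEstep" using i by (auto simp: peaks_iff)
  have s0: "saddle i (i - 1) (Suc i)"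
    using i' H_up[of "i - 1"] H_SE[of i] by (auto simp: saddle_def peaks_iff le_Suc_eq le_eq_less_or_eq)
  let ?S = "{nat (H l) |l m. saddle i l m}"
  define b where "b = (LEAST b. b \<in> ?S)"
  have "b \<in> ?S" unfolding b_def by (rule LeastI[of _ "nat (H (i - 1))"]) (use s0 in blast)
  then obtain l m where lm: "saddle i l m" "b = nat (H l)" by blast
  have min: "H l \<le> H l'" if "saddle i l' m'" for l' m'
  proof -
    have "b \<le> nat (H l')" unfolding b_def by (rule Least_le) (use that in blast)
    moreover have "0 \<le> H l" "0 \<le> H l'" using that lm i' by (auto simp: saddle_def intro!: H_nonneg)
    ultimately show ?thesis using lm by simp
  qed
  have "H (i - 1) < H i" using H_up[of "i - 1"] i' by simp
  then have "H l < H i" using min[OF s0] by simp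
  have "relative_height p i = H i - H l"
    using i lm(1) min by (rule relative_height_eqI)
  then show ?thesis using lm(1) \<open>H l < H i\<close> min by (intro that)
qed

text \<open>Let b be the lowest saddle level, and l and m the nearest vertices at height b on either
  side of i. If l is not a valley, the path climbs to l from b - 1; then minimality forbids it to
  descend from m, so m is a valley. There is no E step between such a valley and i, so height and
  position change with the same parity.\<close>

lemma peak_base_valley:
  assumes i: "i \<in> peaks p"
  shows "\<exists>j\<in>valleys p. even (int i - relative_height p i) \<longleftrightarrow> even j"
proof -
  have i': "0 < i" "i < len" using i by (auto simp: peaks_iff)
  obtain l0 m0 where lm0: "saddle i l0 m0" "relative_height p i = H i - H l0" "H l0 < H i"
    and min: "\<And>l' m'. saddle i l' m' \<Longrightarrow> H l0 \<le> H l'"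
    using relative_height_saddle[OF i] by blast
  let ?b = "H l0"
  have b0: "0 \<le> ?b" using lm0 i' by (auto simp: saddle_def intro!: H_nonneg)
  obtain l where l: "l0 \<le> l" "l < i" "H l = ?b" "up (st l)" "\<And>x. l < x \<Longrightarrow> x \<le> i \<Longrightarrow> ?b < H x"
    using last_at_height[of l0 ?b i] lm0 i' by (auto simp: saddle_def)
  obtain m where m: "i < m" "m \<le> m0" "H m = ?b" "\<And>x. i \<le> x \<Longrightarrow> x < m \<Longrightarrow> ?b < H x"
    using first_at_height[of m0 ?b i] lm0 i' by (auto simp: saddle_def)
  have sad: "saddle i l m" using lm0 l m by (auto simp: saddle_def)
  have mn: "m \<le> len" using sad by (simp add: saddle_def)
  show ?thesis
  proof (cases "l = 0 \<or> \<not> up (st (l - 1))")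
    case True
    then have "l \<in> valleys p" using l i' by (auto simp: valleys_def)
    moreover have "even (H i - H l - (int i - int l))"
    proof (rule height_parity)
      fix x assume "l \<le> x" "x < i"
      then show "st x \<noteq> Estep" using l(4) l(5)[of x] b0 i' not_E[of x] by (cases "x = l") auto
    qed (use l i' in auto)
    ultimately show ?thesis using lm0(2) l(3) by (intro bexI[of _ l]) auto
  next
    case False
    then obtain l' where l': "l = Suc l'" "up (st l')" by (cases l) auto
    have Hl': "H l' = ?b - 1" using H_up[of l'] l' l i' by simp
    then have b1: "1 \<le> ?b" using H_nonneg[of l'] l' l i' by simp
    have "m \<noteq> len" using m(3) b1 H_end by auto
    then have mn': "m < len" using mn by simp
    obtain m' where m': "m = Suc m'" using m(1) by (cases m) auto
    have SE: "st m' = SEstep" using SE_iff[of m'] m(3) m(4)[of m'] m' m(1) mn by auto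
    \<comment> \<open>Otherwise the vertices just outside l and m form a saddle at level b - 1.
      Neither is a peak: the left one is left by an up step, the right one is entered by an SE
      step.\<close>
    have "st m \<noteq> SEstep"
    proof
      assume SEm: "st m = SEstep"
      have "saddle i l' (Suc m)"
        unfolding saddle_def
      proof (intro conjI ballI impI)
        show "H l' = H (Suc m)" using H_SE[OF mn' SEm] m(3) Hl' by simp
        fix j assume j: "j \<in> peaks p"
        { assume "l' \<le> j \<and> j < i"
          moreover have "j \<noteq> l'" using j l' by (auto simp: peaks_iff)
          ultimately show "H j < H i" using j sad l' by (auto simp: saddle_def) }
        { assume "i < j \<and> j \<le> Suc m"
          moreover have "j \<noteq> Suc m" using j SEm by (auto simp: peaks_iff)
          ultimately show "H j \<le> H i" using j sad l' by (auto simp: saddle_def) }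
      qed (use l l' m mn' in auto)
      then show False using min Hl' by force
    qed
    moreover have "st m \<noteq> Estep" using not_E[of m] mn' m(3) b1 by auto
    ultimately have "up (st m)" by (cases "st m") auto
    then have "m \<in> valleys p" using mn' m' SE by (auto simp: valleys_def)
    moreover have "even (H m - H i - (int m - int i))"
    proof (rule height_parity)
      fix x assume "i \<le> x" "x < m"
      then show "st x \<noteq> Estep" using m(4)[of x] b0 mn not_E[of x] by auto
    qed (use m mn in auto)
    ultimately show ?thesis using lm0(2) m(3) by (intro bexI[of _ m]) auto
  qed
qed

text \<open>To the right of the valley, at height v, lies an excursion above v with leftmost maximum
  P; if an earlier vertex has height at most v > 0, there is also one to the left, with leftmost
  maximum L. The lower of these peaks cannot get past the other, so v is its lowest saddle level. A
  tie goes to P, because peaks to the left must be strictly lower.\<close>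

lemma valley_base_of_peak:
  assumes j: "j \<in> valleys p"
  shows "\<exists>i\<in>peaks p. even (int i - relative_height p i) \<longleftrightarrow> even j"
proof -
  have jn: "j < len" and upj: "up (st j)" and j_left: "j = 0 \<or> \<not> up (st (j - 1))"
    using j by (auto simp: valleys_def)
  let ?v = "H j"
  have v0: "0 \<le> ?v" using jn H_nonneg by simp
  have Hj1: "H (Suc j) = ?v + 1" using H_up[OF jn upj] .
  obtain m where m: "Suc j < m" "m \<le> len" "H m = ?v" "\<And>x. Suc j \<le> x \<Longrightarrow> x < m \<Longrightarrow> ?v < H x"
    using first_at_height[of len ?v "Suc j"] H_end v0 Hj1 jn by (auto simp: Suc_le_eq)
  obtain P where P: "j < P" "P < m" "P \<in> peaks p" "\<And>x. j \<le> x \<Longrightarrow> x < P \<Longrightarrow> H x < H P"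
    "\<And>x. j \<le> x \<Longrightarrow> x \<le> m \<Longrightarrow> H x \<le> H P"
    using excursion_peak[of j m ?v] m by (auto simp: Suc_le_eq)
  have sadP: "saddle P j m" using P m by (auto simp: saddle_def)
  have parP: "even (H P - ?v - (int P - int j))"
  proof (rule height_parity)
    fix x assume x: "j \<le> x" "x < P"
    show "st x \<noteq> Estep"
    proof (cases "x = j")
      case False
      then have "?v < H x" "x < len" using m(4)[of x] m(2) P(2) x by auto
      then show ?thesis using not_E[of x] v0 by simp
    qed (use upj in auto)
  qed (use P m in auto)
  have base_P: ?thesis if "\<And>l' m'. saddle P l' m' \<Longrightarrow> ?v \<le> H l'"
    using relative_height_eqI[OF P(3) sadP that] parP P(3) by (intro bexI[of _ P]) auto
  have right: "?v \<le> H x" if "j \<le> x" "x \<le> m" for x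
    using that m(3) m(4)[of x] by (cases "x = j"; cases "x = m") auto
  show ?thesis
  \<comment> \<open>If there is no such vertex, nothing left of the valley is below v, so no saddle
    of P is lower.\<close>
  proof (cases "\<exists>x<j. H x \<le> ?v \<and> 0 < ?v")
    case False
    have "?v \<le> H l'" if "saddle P l' m'" for l' m'
    proof (cases "l' < j")
      case True
      have "0 \<le> H l'" using that by (intro H_nonneg) (auto simp: saddle_def)
      moreover have "\<not> (H l' \<le> ?v \<and> 0 < ?v)" using False True by blast
      ultimately show ?thesis using v0 by linarith
    next
      case False
      then show ?thesis using that P(2) right[of l'] by (auto simp: saddle_def)
    qed
    then show ?thesis by (rule base_P)
  next
    case True
    then obtain x where x: "x < j" "H x \<le> ?v" and v1: "0 < ?v" by blast
    then obtain j' where j': "j = Suc j'" by (cases j) auto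
    \<comment> \<open>An E step would put the valley at height 0.\<close>
    have "st j' \<noteq> Estep" using j' jn v1 H_E[of j'] by (auto simp: height_Suc)
    then have "st j' = SEstep" using j_left j' by (cases "st j'") auto
    then have Hj': "H j' = ?v + 1" using H_SE[of j'] j' jn by simp
    then have "x \<le> j'" using x j' by (auto simp: less_Suc_eq)
    then obtain l where l: "l < j'" "H l = ?v" "\<And>x. l < x \<Longrightarrow> x \<le> j' \<Longrightarrow> ?v < H x"
      using last_at_height[of x ?v j'] x Hj' j' jn by auto
    obtain L where L: "l < L" "L < j" "L \<in> peaks p" "\<And>x. l \<le> x \<Longrightarrow> x < L \<Longrightarrow> H x < H L"
      "\<And>x. l \<le> x \<Longrightarrow> x \<le> j \<Longrightarrow> H x \<le> H L"
      using excursion_peak[of l j ?v] l j' jn by (auto simp: less_Suc_eq_le)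
    have left: "?v \<le> H x" if "l \<le> x" "x \<le> j" for x
      using that l(2) l(3)[of x] j' by (cases "x = l"; cases "x = j") auto
    show ?thesis
    proof (cases "H P \<le> H L")
      case True
      have "?v \<le> H l'" if s: "saddle P l' m'" for l' m'
      proof (cases "l' \<le> L")
        case T: True
        then have "H L < H P" using s L P by (auto simp: saddle_def)
        then show ?thesis using True by simp
      next
        case False
        then show ?thesis using s L P right[of l'] left[of l'] by (cases "l' \<le> j") (auto simp: saddle_def)
      qed
      then show ?thesis by (rule base_P)
    next
      case False
      have sadL: "saddle L l j" using L l jn by (auto simp: saddle_def)
      have "H l \<le> H l'" if s: "saddle L l' m'" for l' m'
      proof (cases "P \<le> m'")
        case T: True
        then have "H P \<le> H L" using s L P by (auto simp: saddle_def)
        then show ?thesis using False by simp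
      next
        case False
        then have "?v \<le> H m'" using s L P right[of m'] left[of m'] by (cases "m' \<le> j") (auto simp: saddle_def)
        then show ?thesis using s l by (simp add: saddle_def)
      qed
      then have rel: "relative_height p L = H L - ?v"
        using relative_height_eqI[OF L(3) sadL] l by simp
      have "even (?v - H L - (int j - int L))"
      proof (rule height_parity)
        fix x assume "L \<le> x" "x < j"
        then show "st x \<noteq> Estep" using L l(3)[of x] v0 not_E[of x] j' jn by auto
      qed (use L jn in auto)
      then show ?thesis using rel L(3) by (intro bexI[of _ L]) auto
    qed
  qed
qed

lemma weight_eq: "i \<le> len \<Longrightarrow> weight p i + int (card {x. x < i \<and> st x = Nstep}) = int i"
proof (induction i)
  case (Suc i)
  have *: "{x. x < Suc i \<and> st x = Nstep} = (if st i = Nstep then {i} else {}) \<union> {x. x < i \<and> st x = Nstep}"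
    by (auto simp: less_Suc_eq)
  have "i \<notin> {x. x < i \<and> st x = Nstep}" by simp
  then show ?case using Suc by (cases "st i") (simp_all add: * weight_Suc)
qed (simp add: weight_def vertex_0)

text \<open>Every north step is followed by an SE step, so W counts the north steps before i. By
  \<open>weight_eq\<close>, the abscissa minus W is then i - 2 W.\<close>

lemma odd_peak_iff:
  assumes i: "i \<in> peaks p"
  shows "odd_peak p i \<longleftrightarrow> even (int i - relative_height p i)"
proof -
  have in_n: "i < len" using i by (simp add: peaks_iff)
  have wl: "weight p j \<le> weight p i \<longleftrightarrow> j \<le> i" if "j < len" for j
    using that weight_mono[of j i] peak_weight_less[OF i, of j] in_n by force
  have "{j \<in> NSE_peaks p. weight p j \<le> weight p i} = {j \<in> NSE_peaks p. j \<le> i}"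
    by (auto simp: NSE_peaks_def wl)
  also have "\<dots> = Suc ` {x. x < i \<and> st x = Nstep}"
  proof (rule set_eqI)
    fix j
    show "j \<in> {j \<in> NSE_peaks p. j \<le> i} \<longleftrightarrow> j \<in> Suc ` {x. x < i \<and> st x = Nstep}"
      using N_SE[of "j - 1"] in_n by (cases j) (auto simp: NSE_peaks_def)
  qed
  finally have "NSE_count p (weight p i) = card {x. x < i \<and> st x = Nstep}"
    unfolding NSE_count_def by (simp add: card_image)
  then have "weight p i = int i - int (NSE_count p (weight p i))"
    using weight_eq[of i] in_n by simp
  then show ?thesis unfolding odd_peak_def by presburger
qed

lemma all_odd_iff: "(\<forall>i\<in>peaks p. odd_peak p i) \<longleftrightarrow> (\<forall>j\<in>valleys p. even j)"
proof -
  have "(\<forall>i\<in>peaks p. odd_peak p i) \<longleftrightarrow> (\<forall>i\<in>peaks p. even (int i - relative_height p i))"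
    using odd_peak_iff by blast
  also have "\<dots> \<longleftrightarrow> (\<forall>j\<in>valleys p. even j)"
    using peak_base_valley valley_base_of_peak by metis
  finally show ?thesis .
qed

end

section \<open>Paths as step lists\<close>

lemma vertex_Cons:
  "vertex (h, s # ss) (Suc i) = vertex (h + snd (displacement s), ss) i + (fst (displacement s), 0)"
  by (cases "displacement s") (simp add: vertex_def)

lemma height_Cons: "height (h, s # ss) (Suc i) = height (h + snd (displacement s), ss) i"
  by (simp add: height_def vertex_Cons)

text \<open>Abscissas do not depend on the starting height, so \<open>h'\<close> is
  arbitrary.\<close>

lemma weight_Cons: "weight (h, s # ss) (Suc i) = weight (h', ss) i + fst (displacement s)"
  by (simp add: weight_def vertex_Cons) (simp add: vertex_def)

lemma height_0: "height p 0 = start_height p"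
  by (simp add: height_def vertex_0)

lemma weight_0: "weight p 0 = 0"
  by (simp add: weight_def vertex_0)

lemma all_le_Suc: "(\<forall>i\<le>Suc n. P i) \<longleftrightarrow> P 0 \<and> (\<forall>i\<le>n. P (Suc i))"
  by (metis Suc_le_mono le0 not0_implies_Suc)

text \<open>The positional counterpart of \<open>odd_suffix\<close>, as the bridge to
  \<open>lattice_path\<close>. Heights are integers, so that leaving the strip from below can be
  expressed; \<open>even i = g\<close> measures parity from the start of the tail.\<close>

definition odd_suffix_spec :: "nat \<Rightarrow> step \<Rightarrow> bool \<Rightarrow> int \<Rightarrow> step list \<Rightarrow> bool" where
  "odd_suffix_spec k u g h ss \<longleftrightarrow>
     (\<forall>i\<le>length ss. 0 \<le> height (h, ss) i \<and> height (h, ss) i < int k) \<and>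
     height (h, ss) (length ss) = 0 \<and>
     (\<forall>i<length ss. ss ! i = Estep \<longrightarrow> height (h, ss) i = 0) \<and>
     (\<forall>i<length ss. ss ! i = Nstep \<longrightarrow> Suc i < length ss \<and> ss ! Suc i = SEstep) \<and>
     last (u # ss) = SEstep \<and>
     (u = Nstep \<longrightarrow> ss \<noteq> [] \<and> hd ss = SEstep) \<and>
     (\<forall>i<length ss. up (ss ! i) \<and> \<not> up ((u # ss) ! i) \<longrightarrow> even i = g)"

lemma odd_suffix_spec_Cons:
  "odd_suffix_spec k u g h (s # ss) \<longleftrightarrow> 0 \<le> h \<and> h < int k \<and> (s = Estep \<longrightarrow> h = 0) \<and> (u = Nstep \<longrightarrow> s = SEstep) \<and>
     (up s \<and> \<not> up u \<longrightarrow> g) \<and> odd_suffix_spec k s (\<not> g) (h + snd (displacement s)) ss"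
proof -
  have N: "(\<forall>i<length (s # ss). (s # ss) ! i = Nstep \<longrightarrow> Suc i < length (s # ss) \<and> (s # ss) ! Suc i = SEstep)
    \<longleftrightarrow> (s = Nstep \<longrightarrow> ss \<noteq> [] \<and> hd ss = SEstep) \<and>
      (\<forall>i<length ss. ss ! i = Nstep \<longrightarrow> Suc i < length ss \<and> ss ! Suc i = SEstep)"
    by (cases ss) (simp_all add: All_less_Suc2)
  show ?thesis
    unfolding odd_suffix_spec_def N
    by (simp add: all_le_Suc All_less_Suc2 height_Cons height_0 del: last.simps)
      (auto simp: last_ConsR)
qed

lemma odd_suffix_spec_Nil: "odd_suffix_spec k u g h [] \<longleftrightarrow> h = 0 \<and> 0 < k \<and> u = SEstep"
  by (auto simp: odd_suffix_spec_def height_0)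

text \<open>\<open>odd_suffix\<close> tests the upper bound only when the path rises, hence the
  assumption on the initial height.\<close>

lemma odd_suffix_spec_iff: "h < k \<Longrightarrow> odd_suffix_spec k u g (int h) ss \<longleftrightarrow> odd_suffix k u g h ss"
proof (induction ss arbitrary: u g h)
  case Nil
  then show ?case by (auto simp: odd_suffix_spec_Nil)
next
  case (Cons s ss)
  have bounds: "0 \<le> h' \<and> h' < int k" if "odd_suffix_spec k u' g' h' ss" for u' g' h'
    using that by (auto simp: odd_suffix_spec_def height_0 dest: spec[of _ 0])
  show ?case
  proof (cases s)
    case NEstep
    have "odd_suffix_spec k NEstep (\<not> g) (int h + 1) ss \<longleftrightarrow> Suc h < k \<and> odd_suffix k NEstep (\<not> g) (Suc h) ss"
      using Cons.IH[of "Suc h" NEstep "\<not> g"] bounds[of NEstep "\<not> g" "int h + 1"]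
      by (cases "Suc h < k") (auto simp: add.commute)
    then show ?thesis using Cons.prems by (auto simp: odd_suffix_spec_Cons NEstep)
  next
    case Nstep
    have "odd_suffix_spec k Nstep (\<not> g) (int h + 1) ss \<longleftrightarrow> Suc h < k \<and> odd_suffix k Nstep (\<not> g) (Suc h) ss"
      using Cons.IH[of "Suc h" Nstep "\<not> g"] bounds[of Nstep "\<not> g" "int h + 1"]
      by (cases "Suc h < k") (auto simp: add.commute)
    then show ?thesis using Cons.prems by (auto simp: odd_suffix_spec_Cons Nstep)
  next
    case SEstep
    have "odd_suffix_spec k SEstep (\<not> g) (int h - 1) ss \<longleftrightarrow> 0 < h \<and> odd_suffix k SEstep (\<not> g) (h - 1) ss"
      using Cons.IH[of "h - 1" SEstep "\<not> g"] bounds[of SEstep "\<not> g" "int h - 1"] Cons.prems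
      by (cases h) auto
    then show ?thesis using Cons.prems by (auto simp: odd_suffix_spec_Cons SEstep)
  next
    case Estep
    then show ?thesis using Cons.prems Cons.IH[of 0 Estep "\<not> g"] by (auto simp: odd_suffix_spec_Cons)
  qed
qed

lemma no_initial_NSE_iff: "no_initial_NSE ss \<longleftrightarrow> \<not> (\<exists>q<length ss. (\<forall>i<q. ss ! i = NEstep) \<and> ss ! q = Nstep)"
proof (induction ss)
  case (Cons s ss)
  have "(\<exists>q<length (s # ss). (\<forall>i<q. (s # ss) ! i = NEstep) \<and> (s # ss) ! q = Nstep) \<longleftrightarrow>
     s = Nstep \<or> s = NEstep \<and> (\<exists>q<length ss. (\<forall>i<q. ss ! i = NEstep) \<and> ss ! q = Nstep)"
    by (auto simp: Ex_less_Suc2 All_less_Suc2)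
  then show ?case using Cons by (cases s) auto
qed simp

text \<open>An opening run of NE steps closed by a north step makes the first peak an NSE peak of a
  path starting upwards. Conversely, before a leftmost NSE peak such a run can only be avoided by
  starting with SE, or with E at the origin.\<close>

lemma first_peak_rule_iff_no_initial_NSE:
  assumes odd_suffix_spec: "odd_suffix_spec k SEstep True h ss"
  defines "p \<equiv> (h, ss)"
  shows "(peaks p \<noteq> {} \<and> Min (peaks p) \<in> NSE_peaks p \<longrightarrow>
        hd (steps p) = SEstep \<or> (start_height p = 0 \<and> hd (steps p) = Estep)) \<longleftrightarrow> no_initial_NSE ss"
proof
  have fin: "finite (peaks p)"
    by (rule finite_subset[of _ "{..<length (steps p)}"]) (auto simp: peaks_iff)
  have st: "steps p = ss" "start_height p = h" by (simp_all add: p_def)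
  assume rule: "peaks p \<noteq> {} \<and> Min (peaks p) \<in> NSE_peaks p \<longrightarrow>
        hd (steps p) = SEstep \<or> (start_height p = 0 \<and> hd (steps p) = Estep)"
  show "no_initial_NSE ss"
  proof (rule ccontr)
    assume "\<not> no_initial_NSE ss"
    then obtain q where q: "q < length ss" "\<And>i. i < q \<Longrightarrow> ss ! i = NEstep" "ss ! q = Nstep"
      by (auto simp: no_initial_NSE_iff)
    then have SE: "Suc q < length ss" "ss ! Suc q = SEstep" using odd_suffix_spec by (auto simp: odd_suffix_spec_def)
    have NSE: "Suc q \<in> NSE_peaks p" using SE q by (auto simp: NSE_peaks_def st)
    have "Suc q \<le> i" if "i \<in> peaks p" for i
      using that q(2)[of i] q(3) by (cases i q rule: linorder_cases) (auto simp: peaks_iff st)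
    then have "Min (peaks p) = Suc q"
      using NSE fin by (intro Min_eqI) (auto simp: peaks_def)
    moreover have "hd ss \<in> {NEstep, Nstep}"
      using q by (cases "q = 0") (auto simp: hd_conv_nth simp flip: length_greater_0_conv)
    ultimately show False using rule NSE by (auto simp: peaks_def st)
  qed
next
  have st: "steps p = ss" "start_height p = h" by (simp_all add: p_def)
  have fin: "finite (peaks p)"
    by (rule finite_subset[of _ "{..<length (steps p)}"]) (auto simp: peaks_iff)
  assume "no_initial_NSE ss"
  show "peaks p \<noteq> {} \<and> Min (peaks p) \<in> NSE_peaks p \<longrightarrow>
        hd (steps p) = SEstep \<or> (start_height p = 0 \<and> hd (steps p) = Estep)"
  proof (rule impI, elim conjE)
    assume ne: "peaks p \<noteq> {}" and M: "Min (peaks p) \<in> NSE_peaks p"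
    define M where "M = Min (peaks p)"
    obtain m where m: "M = Suc m" "Suc m < length ss" "ss ! m = Nstep"
      using M by (cases M) (auto simp: NSE_peaks_def M_def st)
    have "\<exists>i<m. ss ! i \<noteq> NEstep"
      using \<open>no_initial_NSE ss\<close> m unfolding no_initial_NSE_iff by (meson Suc_lessD)
    then obtain i where i: "i < m" "ss ! i \<noteq> NEstep" "\<And>x. x < i \<Longrightarrow> ss ! x = NEstep"
      using exists_least_iff[of "\<lambda>i. i < m \<and> ss ! i \<noteq> NEstep"] by (metis order.strict_trans)
    have "ss ! i \<noteq> Nstep" using \<open>no_initial_NSE ss\<close> i m unfolding no_initial_NSE_iff by (meson Suc_lessD less_trans)
    \<comment> \<open>For i > 0 the preceding NE steps would end in an NESE peak left of the
      leftmost peak.\<close>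
    moreover have i0: "i = 0" if "ss ! i = SEstep"
    proof (rule ccontr)
      assume "i \<noteq> 0"
      then have "i \<in> peaks p" using i(3)[of "i - 1"] that i m by (auto simp: peaks_iff st)
      then have "M \<le> i" unfolding M_def using fin by (intro Min_le)
      then show False using i m by simp
    qed
    \<comment> \<open>An E step needs height 0, which an NE step from a nonnegative height cannot
      reach.\<close>
    moreover have "i = 0 \<and> h = 0" if "ss ! i = Estep"
    proof -
      have Hi: "height p i = 0" using that odd_suffix_spec i m by (auto simp: odd_suffix_spec_def p_def)
      have "i = 0"
      proof (rule ccontr)
        assume "i \<noteq> 0"
        then obtain i' where i': "i = Suc i'" by (cases i) auto
        have "0 \<le> height p i'" using odd_suffix_spec i i' m by (auto simp: odd_suffix_spec_def p_def)
        moreover have "height p i = height p i' + 1"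
          using height_Suc[of i' p] i(3)[of i'] i' i m by (simp add: st)
        ultimately show False using Hi by simp
      qed
      then show ?thesis using Hi by (simp add: height_0 st)
    qed
    moreover have "hd ss = ss ! 0" using m by (intro hd_conv_nth) auto
    ultimately show "hd (steps p) = SEstep \<or> (start_height p = 0 \<and> hd (steps p) = Estep)"
      using i(2) by (cases "ss ! i") (auto simp: st)
  qed
qed

text \<open>Generalised over the preceding step \<open>u\<close>, which decides whether index 0
  counts as a peak; its weight there is 0.\<close>

lemma sum_peaks:
  fixes h :: int
  defines "P \<equiv> \<lambda>u ss. {i. i < length ss \<and> ss ! i = SEstep \<and> up ((u # ss) ! i)}"
  shows "card (P u ss) = num_peaks u ss \<and> (\<Sum>i\<in>P u ss. weight (h, ss) i) = int (maj u ss)"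
proof (induction ss arbitrary: u)
  case Nil
  show ?case by (simp add: P_def)
next
  case (Cons s ss)
  have fin: "finite (P u ss)" for u ss by (simp add: P_def)
  have P: "P u (s # ss) = (if s = SEstep \<and> up u then {0} else {}) \<union> Suc ` P s ss"
    (is "_ = ?A \<union> _")
  proof (rule set_eqI)
    fix i
    show "i \<in> P u (s # ss) \<longleftrightarrow> i \<in> ?A \<union> Suc ` P s ss"
      by (cases i) (auto simp: P_def)
  qed
  have disj: "?A \<inter> Suc ` P s ss = {}" by auto
  have "card (P u (s # ss)) = num_peaks u (s # ss)"
    unfolding P using Cons fin disj by (subst card_Un_disjoint) (auto simp: card_image)
  moreover have "(\<Sum>i\<in>P u (s # ss). weight (h, s # ss) i) = int (maj u (s # ss))"
  proof -
    have "(\<Sum>i\<in>P u (s # ss). weight (h, s # ss) i) = (\<Sum>i\<in>P s ss. weight (h, ss) i + fst (displacement s))"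
      unfolding P using fin disj
      by (subst sum.union_disjoint) (auto simp: sum.reindex weight_0 weight_Cons[where h' = h])
    also have "\<dots> = int (maj s ss) + int (num_peaks s ss) * fst (displacement s)"
      using Cons[of s] by (simp add: sum.distrib)
    finally show ?thesis by (cases s) auto
  qed
  ultimately show ?case by blast
qed

lemma major_index_eq_maj: "major_index (h, ss) = int (maj SEstep ss)"
proof -
  have "peaks (h, ss) = {i. i < length ss \<and> ss ! i = SEstep \<and> up ((SEstep # ss) ! i)}"
  proof (rule set_eqI)
    fix i
    show "i \<in> peaks (h, ss) \<longleftrightarrow> i \<in> {i. i < length ss \<and> ss ! i = SEstep \<and> up ((SEstep # ss) ! i)}"
      by (cases i) (auto simp: peaks_iff)
  qed
  then show ?thesis unfolding major_index_def using sum_peaks[where u = SEstep and ss = ss and h = h] by simp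
qed

lemma valleys_even_iff:
  "(\<forall>j\<in>valleys (h, ss). even j) \<longleftrightarrow>
   (\<forall>i<length ss. up (ss ! i) \<and> \<not> up ((SEstep # ss) ! i) \<longrightarrow> even i = True)"
proof -
  have "j \<in> valleys (h, ss) \<longleftrightarrow> j < length ss \<and> up (ss ! j) \<and> \<not> up ((SEstep # ss) ! j)" for j
    by (cases j) (auto simp: valleys_def)
  then show ?thesis by blast
qed

lemma admissible_path_iff:
  assumes "1 \<le> a" "a \<le> k"
  shows "lattice_path p \<and> special_conditions k a p \<and> (\<forall>i\<in>peaks p. odd_peak p i) \<longleftrightarrow>
    start_height p = int (k - a) \<and> odd_suffix k SEstep True (k - a) (steps p) \<and> no_initial_NSE (steps p)"
proof -
  obtain h ss where p: "p = (h, ss)" by (cases p)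
  have "lattice_path p \<and> special_conditions k a p \<and> (\<forall>i\<in>peaks p. odd_peak p i) \<longleftrightarrow>
     lattice_path p \<and> special_conditions k a p \<and> (\<forall>j\<in>valleys p. even j)"
    using all_odd_iff by blast
  also have "\<dots> \<longleftrightarrow> start_height p = int (k - a) \<and> odd_suffix_spec k SEstep True (start_height p) (steps p) \<and>
    (peaks p \<noteq> {} \<and> Min (peaks p) \<in> NSE_peaks p \<longrightarrow>
        hd (steps p) = SEstep \<or> (start_height p = 0 \<and> hd (steps p) = Estep))"
    using assms unfolding p valleys_even_iff
    by (auto simp: lattice_path_def special_conditions_def odd_suffix_spec_def of_nat_diff simp del: nth_Cons_Suc)
  also have "\<dots> \<longleftrightarrow> start_height p = int (k - a) \<and> odd_suffix_spec k SEstep True (start_height p) (steps p) \<and> no_initial_NSE (steps p)"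
    using first_peak_rule_iff_no_initial_NSE[of k h ss] by (auto simp: p)
  also have "\<dots> \<longleftrightarrow> start_height p = int (k - a) \<and> odd_suffix k SEstep True (k - a) (steps p) \<and> no_initial_NSE (steps p)"
    using odd_suffix_spec_iff[of "k - a" k SEstep True "steps p"] assms by auto
  finally show ?thesis .
qed

lemma J_eq_card_odd_suffix:
  assumes "1 \<le> a" "a \<le> k"
  shows "J k a n = card {ss. (odd_suffix k SEstep True (k - a) ss \<and> no_initial_NSE ss) \<and> maj SEstep ss = n}"
proof -
  have "{p. lattice_path p \<and> special_conditions k a p \<and> major_index p = int n \<and> (\<forall>i\<in>peaks p. odd_peak p i)}
    = Pair (int (k - a)) ` {ss. (odd_suffix k SEstep True (k - a) ss \<and> no_initial_NSE ss) \<and> maj SEstep ss = n}"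
    (is "?L = ?R")
  proof (rule set_eqI)
    fix p
    show "p \<in> ?L \<longleftrightarrow> p \<in> ?R"
      using admissible_path_iff[OF assms, of p] major_index_eq_maj[of "fst p" "snd p"]
      by (cases p) auto
  qed
  then show ?thesis unfolding J_def by (simp add: card_image inj_on_def)
qed

theorem theorem1p6:
  fixes k a :: nat
  assumes "1 \<le> a" and "a \<le> k"
  shows "((\<lambda>ns. let N = partial_sum_N k ns in
            fps_X ^ (N 1 * (N 1 + 1) div 2 + (\<Sum>i\<in>{2..<k}. (N i)\<^sup>2)
                       + (\<Sum>j | 1 \<le> j \<and> a + 2 * j \<le> k - 1. 2 * N (a + 2 * j)))
            * qpoch (- fps_X) fps_X (int (N 1) - 1)
            * (fps_X ^ N 1 + fps_X ^ (2 * N a))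
            / (\<Prod>i\<in>{1..<k}. qpoch (fps_X\<^sup>2) (fps_X\<^sup>2) (int (ns i))))
          has_sum Abs_fps (\<lambda>n. of_nat (J k a n) :: rat))
         ({1..<k} \<rightarrow>\<^sub>E UNIV)"
  using has_sum_full_summand[OF assms J_eq_card_odd_suffix[OF assms]]
  unfolding full_summand_def .

end
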